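(* In the setting of the context, fix an initial condition $(\xi_0,\tau_0,\zeta_0)$ with $\tau_0\ge 0$ componentwise. Consider the controlled system, for $i\in\mathcal V$, $j\in\mathcal E$, $$\dot\xi_i=b_i\mathbb 1_{\rho_i}\phi_i+I_{o\rho_i}u_i,\qquad \dot\tau_i=\big[\hat b_i\mathbb 1_{\hat\rho_i}G_i(\theta_i)+I_{o\hat\rho_i}\hat u_i\big]^+_{\tau_i},\qquad \dot\zeta_j=\check b_j\mathbb 1_{\check\rho_j}\omega_j+I_{o\check\rho_j}\check u_j,$$ with $\theta_i=\mathbb 1_{\rho_i}^T\xi_i$, $\lambda_i=\mathbb 1_{\hat\rho_i}^T\tau_i$, $\mu_j=\mathbb 1_{\check\rho_j}^T\zeta_j$ and initial condition $(\xi_0,\tau_0,\zeta_0)$, and the optimal control problem $$\min_U\ \int_0^\infty \|U\|_R^2+\sum_{i\in\mathcal V}q_i+\sum_{i\in\mathcal V}\hat q_i+\sum_{j\in\mathcal E}\check q_j\ dt,\qquad U=\begin{bmatrix}[u_i]_{i\in\mathcal V}^T&[\hat u_i]_{i\in\mathcal V}^T&[\check u_j]_{j\in\mathcal E}^T\end{bmatrix}^T,$$ where the minimization is over all stabilizing control inputs $U$, where $R=\mathrm{diag}[\oplus_{i\in\mathcal V}R_i,\ \oplus_{i\in\mathcal V}\hat R_i,\ \oplus_{j\in\mathcal E}\check R_j]$ with $$R_i=\tfrac12\mathrm{diag}\Big[\tfrac1{a_{i2}b_{i2}},\ldots,\tfrac1{a_{i\rho_i}b_{i\rho_i}}\Big],\quad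 \hat R_i=\tfrac12\mathrm{diag}\Big[\tfrac1{\hat a_{i2}\hat b_{i2}},\ldots,\tfrac1{\hat a_{i\hat\rho_i}\hat b_{i\hat\rho_i}}\Big],\quad \check R_j=\tfrac12\mathrm{diag}\Big[\tfrac1{\check a_{j2}\check b_{j2}},\ldots,\tfrac1{\check a_{j\check\rho_j}\check b_{j\check\rho_j}}\Big],$$ and where $$q_i=(\theta_i-\theta_i^* )(\nabla F_i(\theta_i)-\nabla F_i(\theta_i^* ))+(\theta_i-\theta_i^* )(\eta_i-\eta_i^* )+\sum_{k=2}^{\rho_i}\frac{a_{ik}}{2b_{ik}}\xi_{ik}^2,$$ $$\hat q_i=-(\tau_{i1}-\lambda_i^* )[G_i(\theta_i)]^+_{\tau_{i1}}-\sum_{k=2}^{\hat\rho_i}\tau_{ik}G_i(\theta_i)+\sum_{k=2}^{\hat\rho_i}\frac{\hat a_{ik}}{2\hat b_{ik}}\tau_{ik}^2,\qquad \check q_j=\sum_{k=2}^{\check\rho_j}\frac{\check a_{jk}}{2\check b_{jk}}\zeta_{jk}^2.$$ Then the optimal solution of this optimal control problem is $U=\underline U=\begin{bmatrix}[\underline u_i]_{i\in\mathcal V}^T&[\underline{\hat u}_i]_{i\in\mathcal V}^T&[\underline{\check u}_j]_{j\in\mathcal E}^T\end{bmatrix}^T$ given by $$\underline u_i=[-a_{i2}\xi_{i2},\ldots,-a_{i\rho_i}\xi_{i\rho_i}]^T,\quad \underline{\hat u}_i=[-\hat a_{i2}\tau_{i2},\ldots,-\hat a_{i\hat\rho_i}\tau_{i\hat\rho_i}]^T,\quad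 \underline{\check u}_j=[-\check a_{j2}\zeta_{j2},\ldots,-\check a_{j\check\rho_j}\zeta_{j\check\rho_j}]^T.$$
   Context: Notation: $\|x\|_R^2=x^TRx$; $\oplus$ denotes block-diagonal direct sum; $[a_k]_{k\in K}$ denotes stacking into a column vector; $\mathbb 1_n$, $\mathbb 0_n$ are the vectors of ones and zeros in $\mathbb R^n$; $I_{on}:=\begin{bmatrix}\mathbb 0_{n-1}&I_{n-1}\end{bmatrix}^T\in\mathbb R^{n\times(n-1)}$. For vectors $\sigma,\epsilon$ of equal dimension, $([\sigma]^+_\epsilon)_k=\sigma_k$ if $\epsilon_k>0$, or if $\epsilon_k=0$ and $\sigma_k\ge0$; and $([\sigma]^+_\epsilon)_k=0$ if $\epsilon_k=0$ and $\sigma_k<0$. Optimization problem: $\mathcal G(\mathcal V,\mathcal E)$ is a finite connected directed graph with node set $\mathcal V$ and edge set $\mathcal E$. For each $i\in\mathcal V$, $F_i:\mathbb R\to\mathbb R$ and $G_i:\mathbb R\to\mathbb R$ are convex and continuously differentiable, with locally Lipschitz derivatives. $\mathcal A\in\mathbb R^{|\mathcal V|\times|\mathcal E|}$ is a matrix such that $\mathcal A^T\theta=0$ enforces $\theta_p=\theta_q$ for all $p,q\in\mathcal V$. The problem is to minimize $F(\theta)=\sum_{i\in\mathcal V}F_i(\theta_i)$ over $\theta\in\mathbb R^{|\mathcal V|}$ subject to $G_i(\theta_i)\le0$ for all $i\in\mathcal V$ and $\mathcal A^T\theta=0$. Slater's condition holds and $F$ is bounded below on the feasible set. With $\nabla G(\theta)=\mathrm{diag}[\nabla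 G_i(\theta_i)]_{i\in\mathcal V}$, an optimal solution $(\theta^*,\lambda^*,\mu^* )\in\mathbb R^{|\mathcal V|}\times\mathbb R^{|\mathcal V|}\times\mathbb R^{|\mathcal E|}$ is a triple satisfying the KKT conditions $\nabla F(\theta^* )+\nabla G(\theta^* )\lambda^*+\mathcal A\mu^*=0$; $\lambda_i^*G_i(\theta_i^* )=0$, $\lambda_i^*\ge0$, $G_i(\theta_i^* )\le0$ for all $i$; $\mathcal A^T\theta^*=0$. Interconnection variables: $\omega=[\omega_j]_{j\in\mathcal E}=\mathcal A^T\theta$, $\eta=[\eta_i]_{i\in\mathcal V}=\nabla G(\theta)\lambda$, $\psi=\mathcal A\mu$, $\phi=[\phi_i]_{i\in\mathcal V}=-\nabla F(\theta)-\eta-\psi$, where $\theta=[\theta_i]$, $\lambda=[\lambda_i]$, $\mu=[\mu_j]$; and $\eta^*=\nabla G(\theta^* )\lambda^*$. States and parameters: $\xi_i=[\xi_{i1},\ldots,\xi_{i\rho_i}]^T\in\mathbb R^{\rho_i}$, $\tau_i=[\tau_{i1},\ldots,\tau_{i\hat\rho_i}]^T\in\mathbb R_{\ge0}^{\hat\rho_i}$, $\zeta_j=[\zeta_{j1},\ldots,\zeta_{j\check\rho_j}]^T\in\mathbb R^{\check\rho_j}$, with $\rho_i,\hat\rho_i,\check\rho_j\ge1$ integers; $u_i(t)\in\mathbb R^{\rho_i-1}$, $\hat u_i(t)\in\mathbb R^{\hat\rho_i-1}$, $\check u_j(t)\in\mathbb R^{\check\rho_j-1}$. $b_i=\mathrm{diag}[b_{i1},\ldots,b_{i\rho_i}]$,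 $\hat b_i=\mathrm{diag}[\hat b_{i1},\ldots,\hat b_{i\hat\rho_i}]$, $\check b_j=\mathrm{diag}[\check b_{j1},\ldots,\check b_{j\check\rho_j}]$ with all diagonal entries positive; $a_{i\rho_i}>\cdots>a_{i2}>0$, and likewise for $\hat a_{ik}$ and $\check a_{jk}$. Stabilizing inputs: with $U=\underline U$ the system becomes the augmented primal-dual algorithm, which (e.g. if $F$ is strictly convex, or if $\rho_i\ge2$ for all $i$) converges from the given initial condition to an equilibrium point at which $(\theta,\lambda,\mu)$ equals an optimal solution; $(\theta^*,\lambda^*,\mu^* )$ denotes this particular optimal solution, to which convergence under $\underline U$ is assumed. A control input $U$ (an arbitrary function of time, allowed at time $t$ to depend on the history of the process up to $t$) is stabilizing if the system states converge to an equilibrium point at which $(\theta,\lambda,\mu)=(\theta^*,\lambda^*,\mu^* )$. *)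

theory Defs
  imports "HOL-Analysis.Analysis" "Graph_Theory.Digraph_Component"
begin

text \<open>
  Vectors indexed by nodes, arcs or \<open>1, \<dots>, n\<close> are functions; only the values at nodes in
  \<open>verts\<close>, arcs in \<open>arcs\<close> and at indices \<open>1, \<dots>, n\<close> are ever used. In \<open>pd_system\<close>, \<open>obj\<close> and \<open>con\<close>
  are the local functions \<open>F\<^sub>i\<close> and \<open>G\<^sub>i\<close>, and \<open>mat\<close> is the matrix whose transpose enforces consensus.
\<close>

record ('v, 'e) pd_system =
  net :: "('v, 'e) pre_digraph"
  obj :: "'v \<Rightarrow> real \<Rightarrow> real"
  con :: "'v \<Rightarrow> real \<Rightarrow> real"
  mat :: "'v \<Rightarrow> 'e \<Rightarrow> real"
  rho_xi :: "'v \<Rightarrow> nat"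
  rho_tau :: "'v \<Rightarrow> nat"
  rho_zeta :: "'e \<Rightarrow> nat"
  a_xi :: "'v \<Rightarrow> nat \<Rightarrow> real"
  a_tau :: "'v \<Rightarrow> nat \<Rightarrow> real"
  a_zeta :: "'e \<Rightarrow> nat \<Rightarrow> real"
  b_xi :: "'v \<Rightarrow> nat \<Rightarrow> real"
  b_tau :: "'v \<Rightarrow> nat \<Rightarrow> real"
  b_zeta :: "'e \<Rightarrow> nat \<Rightarrow> real"

abbreviation nodes :: "('v, 'e) pd_system \<Rightarrow> 'v set" where
  "nodes P \<equiv> verts (net P)"

abbreviation edges :: "('v, 'e) pd_system \<Rightarrow> 'e set" where
  "edges P \<equiv> arcs (net P)"


subsection \<open>The constrained consensus problem\<close>

definition mat_mult :: "('v, 'e) pd_system \<Rightarrow> ('e \<Rightarrow> real) \<Rightarrow> 'v \<Rightarrow> real" where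
  "mat_mult P m i = (\<Sum>j\<in>edges P. mat P i j * m j)"

definition mat_transpose_mult :: "('v, 'e) pd_system \<Rightarrow> ('v \<Rightarrow> real) \<Rightarrow> 'e \<Rightarrow> real" where
  "mat_transpose_mult P th j = (\<Sum>i\<in>nodes P. mat P i j * th i)"

definition objective :: "('v, 'e) pd_system \<Rightarrow> ('v \<Rightarrow> real) \<Rightarrow> real" where
  "objective P th = (\<Sum>i\<in>nodes P. obj P i (th i))"

definition feasible :: "('v, 'e) pd_system \<Rightarrow> ('v \<Rightarrow> real) \<Rightarrow> bool" where
  "feasible P th \<longleftrightarrow>
     (\<forall>i\<in>nodes P. con P i (th i) \<le> 0) \<and> (\<forall>j\<in>edges P. mat_transpose_mult P th j = 0)"

definition slater :: "('v, 'e) pd_system \<Rightarrow> bool" where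
  "slater P \<longleftrightarrow> (\<exists>th. feasible P th \<and> (\<forall>i\<in>nodes P. con P i (th i) < 0))"

definition kkt_point ::
  "('v, 'e) pd_system \<Rightarrow> ('v \<Rightarrow> real) \<Rightarrow> ('v \<Rightarrow> real) \<Rightarrow> ('e \<Rightarrow> real) \<Rightarrow> bool" where
  "kkt_point P ths las mus \<longleftrightarrow>
     (\<forall>i\<in>nodes P. deriv (obj P i) (ths i) + deriv (con P i) (ths i) * las i
                    + mat_mult P mus i = 0) \<and>
     (\<forall>i\<in>nodes P. las i * con P i (ths i) = 0 \<and> las i \<ge> 0 \<and> con P i (ths i) \<le> 0) \<and>
     (\<forall>j\<in>edges P. mat_transpose_mult P ths j = 0)"

definition locally_lipschitz :: "(real \<Rightarrow> real) \<Rightarrow> bool" where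
  "locally_lipschitz f \<longleftrightarrow> (\<forall>x. \<exists>e>0. \<exists>L. L-lipschitz_on (cball x e) f)"

definition smooth_convex :: "(real \<Rightarrow> real) \<Rightarrow> bool" where
  "smooth_convex f \<longleftrightarrow>
     convex_on UNIV f \<and> f C1_differentiable_on UNIV \<and> locally_lipschitz (deriv f)"

definition increasing_gains :: "nat \<Rightarrow> (nat \<Rightarrow> real) \<Rightarrow> bool" where
  "increasing_gains n a \<longleftrightarrow> strict_mono_on {2..n} a \<and> (\<forall>k\<in>{2..n}. 0 < a k)"

definition pd_setting :: "('v, 'e) pd_system \<Rightarrow> bool" where
  "pd_setting P \<longleftrightarrow>
     fin_digraph (net P) \<and> Digraph_Component.connected (net P) \<and>
     (\<forall>i\<in>nodes P. smooth_convex (obj P i) \<and> smooth_convex (con P i)) \<and>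
     (\<forall>th. (\<forall>j\<in>edges P. mat_transpose_mult P th j = 0)
             \<longrightarrow> (\<forall>p\<in>nodes P. \<forall>q\<in>nodes P. th p = th q)) \<and>
     slater P \<and>
     (\<exists>c. \<forall>th. feasible P th \<longrightarrow> c \<le> objective P th) \<and>
     (\<forall>i\<in>nodes P. rho_xi P i \<ge> 1 \<and> rho_tau P i \<ge> 1) \<and>
     (\<forall>j\<in>edges P. rho_zeta P j \<ge> 1) \<and>
     (\<forall>i\<in>nodes P. (\<forall>k\<in>{1..rho_xi P i}. 0 < b_xi P i k) \<and>
                    (\<forall>k\<in>{1..rho_tau P i}. 0 < b_tau P i k)) \<and>
     (\<forall>j\<in>edges P. \<forall>k\<in>{1..rho_zeta P j}. 0 < b_zeta P j k) \<and>
     (\<forall>i\<in>nodes P. increasing_gains (rho_xi P i) (a_xi P i) \<and>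
                    increasing_gains (rho_tau P i) (a_tau P i)) \<and>
     (\<forall>j\<in>edges P. increasing_gains (rho_zeta P j) (a_zeta P j))"


subsection \<open>States, inputs and the controlled vector field\<close>

record ('v, 'e) state =
  xi :: "'v \<Rightarrow> nat \<Rightarrow> real"
  tau :: "'v \<Rightarrow> nat \<Rightarrow> real"
  zeta :: "'e \<Rightarrow> nat \<Rightarrow> real"

text \<open>
  The input blocks are indexed by \<open>k = 2, \<dots>, n\<close>, i.e. by the state component they act on.
\<close>

record ('v, 'e) inp =
  u_xi :: "'v \<Rightarrow> nat \<Rightarrow> real"
  u_tau :: "'v \<Rightarrow> nat \<Rightarrow> real"
  u_zeta :: "'e \<Rightarrow> nat \<Rightarrow> real"

text \<open>Multiplication by the matrix \<open>[0 I]\<^sup>T\<close> with \<open>n\<close> rows and \<open>n - 1\<close> columns.\<close>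

definition embed_input :: "(nat \<Rightarrow> real) \<Rightarrow> nat \<Rightarrow> real" where
  "embed_input u k = (if k = 1 then 0 else u k)"

text \<open>
  The operator \<open>[s]\<^sup>+\<close> with subscript \<open>e\<close>, defined for \<open>e \<ge> 0\<close>. The value for \<open>e < 0\<close> is
  irrelevant, since all trajectories and equilibria below are required to have \<open>tau \<ge> 0\<close>.
\<close>

definition pos_proj :: "real \<Rightarrow> real \<Rightarrow> real" where
  "pos_proj s e = (if e > 0 \<or> (e = 0 \<and> s \<ge> 0) then s else 0)"

definition theta :: "('v, 'e) pd_system \<Rightarrow> ('v, 'e) state \<Rightarrow> 'v \<Rightarrow> real" where
  "theta P s i = (\<Sum>k=1..rho_xi P i. xi s i k)"

definition lam :: "('v, 'e) pd_system \<Rightarrow> ('v, 'e) state \<Rightarrow> 'v \<Rightarrow> real" where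
  "lam P s i = (\<Sum>k=1..rho_tau P i. tau s i k)"

definition mu :: "('v, 'e) pd_system \<Rightarrow> ('v, 'e) state \<Rightarrow> 'e \<Rightarrow> real" where
  "mu P s j = (\<Sum>k=1..rho_zeta P j. zeta s j k)"

definition omega :: "('v, 'e) pd_system \<Rightarrow> ('v, 'e) state \<Rightarrow> 'e \<Rightarrow> real" where
  "omega P s = mat_transpose_mult P (theta P s)"

definition eta :: "('v, 'e) pd_system \<Rightarrow> ('v, 'e) state \<Rightarrow> 'v \<Rightarrow> real" where
  "eta P s i = deriv (con P i) (theta P s i) * lam P s i"

definition psi :: "('v, 'e) pd_system \<Rightarrow> ('v, 'e) state \<Rightarrow> 'v \<Rightarrow> real" where
  "psi P s = mat_mult P (mu P s)"

definition phi :: "('v, 'e) pd_system \<Rightarrow> ('v, 'e) state \<Rightarrow> 'v \<Rightarrow> real" where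
  "phi P s i = - deriv (obj P i) (theta P s i) - eta P s i - psi P s i"

definition xi_field ::
  "('v, 'e) pd_system \<Rightarrow> ('v, 'e) state \<Rightarrow> ('v, 'e) inp \<Rightarrow> 'v \<Rightarrow> nat \<Rightarrow> real" where
  "xi_field P s u i k = b_xi P i k * phi P s i + embed_input (u_xi u i) k"

definition tau_field ::
  "('v, 'e) pd_system \<Rightarrow> ('v, 'e) state \<Rightarrow> ('v, 'e) inp \<Rightarrow> 'v \<Rightarrow> nat \<Rightarrow> real" where
  "tau_field P s u i k =
     pos_proj (b_tau P i k * con P i (theta P s i) + embed_input (u_tau u i) k) (tau s i k)"

definition zeta_field ::
  "('v, 'e) pd_system \<Rightarrow> ('v, 'e) state \<Rightarrow> ('v, 'e) inp \<Rightarrow> 'e \<Rightarrow> nat \<Rightarrow> real" where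
  "zeta_field P s u j k = b_zeta P j k * omega P s j + embed_input (u_zeta u j) k"

definition tau_nonneg :: "('v, 'e) pd_system \<Rightarrow> ('v, 'e) state \<Rightarrow> bool" where
  "tau_nonneg P s \<longleftrightarrow> (\<forall>i\<in>nodes P. \<forall>k\<in>{1..rho_tau P i}. 0 \<le> tau s i k)"


subsection \<open>Controls and trajectories\<close>

text \<open>
  A control determines the input at time \<open>t\<close> from \<open>t\<close> and the state trajectory. Causality restricts
  the dependence to the trajectory up to time \<open>t\<close>; open-loop inputs ignore the trajectory.
\<close>

type_synonym ('v, 'e) control = "real \<Rightarrow> (real \<Rightarrow> ('v, 'e) state) \<Rightarrow> ('v, 'e) inp"

definition causal :: "('v, 'e) control \<Rightarrow> bool" where
  "causal U \<longleftrightarrow> (\<forall>t\<ge>0. \<forall>x y. (\<forall>r\<in>{0..t}. x r = y r) \<longrightarrow> U t x = U t y)"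

text \<open>
  \<open>y\<close> is a Caratheodory solution of \<open>y' = f\<close>, \<open>y 0 = y0\<close>: locally absolutely continuous with the
  differential equation holding almost everywhere. Classical solutions do not exist in general
  because of the discontinuity of \<open>pos_proj\<close>.
\<close>

definition caratheodory_solution :: "(real \<Rightarrow> real) \<Rightarrow> (real \<Rightarrow> real) \<Rightarrow> real \<Rightarrow> bool" where
  "caratheodory_solution f y y0 \<longleftrightarrow>
     (\<forall>t\<ge>0. f absolutely_integrable_on {0..t} \<and> y t = y0 + integral {0..t} f)"

definition trajectory ::
  "('v, 'e) pd_system \<Rightarrow> ('v, 'e) state \<Rightarrow> ('v, 'e) control \<Rightarrow> (real \<Rightarrow> ('v, 'e) state) \<Rightarrow> bool" where
  "trajectory P s0 U x \<longleftrightarrow>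
     (\<forall>t\<ge>0. tau_nonneg P (x t)) \<and>
     (\<forall>i\<in>nodes P. \<forall>k\<in>{1..rho_xi P i}.
        caratheodory_solution (\<lambda>t. xi_field P (x t) (U t x) i k) (\<lambda>t. xi (x t) i k) (xi s0 i k)) \<and>
     (\<forall>i\<in>nodes P. \<forall>k\<in>{1..rho_tau P i}.
        caratheodory_solution (\<lambda>t. tau_field P (x t) (U t x) i k) (\<lambda>t. tau (x t) i k) (tau s0 i k)) \<and>
     (\<forall>j\<in>edges P. \<forall>k\<in>{1..rho_zeta P j}.
        caratheodory_solution (\<lambda>t. zeta_field P (x t) (U t x) j k) (\<lambda>t. zeta (x t) j k) (zeta s0 j k))"

definition measurable_input ::
  "('v, 'e) pd_system \<Rightarrow> (real \<Rightarrow> ('v, 'e) inp) \<Rightarrow> bool" where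
  "measurable_input P v \<longleftrightarrow>
     (\<forall>i\<in>nodes P. \<forall>k\<in>{2..rho_xi P i}.
        (\<lambda>t. u_xi (v t) i k) \<in> borel_measurable (lebesgue_on {0..})) \<and>
     (\<forall>i\<in>nodes P. \<forall>k\<in>{2..rho_tau P i}.
        (\<lambda>t. u_tau (v t) i k) \<in> borel_measurable (lebesgue_on {0..})) \<and>
     (\<forall>j\<in>edges P. \<forall>k\<in>{2..rho_zeta P j}.
        (\<lambda>t. u_zeta (v t) j k) \<in> borel_measurable (lebesgue_on {0..}))"

text \<open>States at which the controlled system is at rest under some constant input.\<close>

definition equilibrium_point :: "('v, 'e) pd_system \<Rightarrow> ('v, 'e) state \<Rightarrow> bool" where
  "equilibrium_point P s \<longleftrightarrow> tau_nonneg P s \<and>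
     (\<exists>u. (\<forall>i\<in>nodes P. \<forall>k\<in>{1..rho_xi P i}. xi_field P s u i k = 0) \<and>
          (\<forall>i\<in>nodes P. \<forall>k\<in>{1..rho_tau P i}. tau_field P s u i k = 0) \<and>
          (\<forall>j\<in>edges P. \<forall>k\<in>{1..rho_zeta P j}. zeta_field P s u j k = 0))"

definition state_converges ::
  "('v, 'e) pd_system \<Rightarrow> (real \<Rightarrow> ('v, 'e) state) \<Rightarrow> ('v, 'e) state \<Rightarrow> bool" where
  "state_converges P x s \<longleftrightarrow>
     (\<forall>i\<in>nodes P. \<forall>k\<in>{1..rho_xi P i}. ((\<lambda>t. xi (x t) i k) \<longlongrightarrow> xi s i k) at_top) \<and>
     (\<forall>i\<in>nodes P. \<forall>k\<in>{1..rho_tau P i}. ((\<lambda>t. tau (x t) i k) \<longlongrightarrow> tau s i k) at_top) \<and>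
     (\<forall>j\<in>edges P. \<forall>k\<in>{1..rho_zeta P j}. ((\<lambda>t. zeta (x t) j k) \<longlongrightarrow> zeta s j k) at_top)"

definition converges_to_optimum ::
  "('v, 'e) pd_system \<Rightarrow> ('v \<Rightarrow> real) \<Rightarrow> ('v \<Rightarrow> real) \<Rightarrow> ('e \<Rightarrow> real)
     \<Rightarrow> (real \<Rightarrow> ('v, 'e) state) \<Rightarrow> bool" where
  "converges_to_optimum P ths las mus x \<longleftrightarrow>
     (\<exists>s. equilibrium_point P s \<and> state_converges P x s \<and>
          (\<forall>i\<in>nodes P. theta P s i = ths i \<and> lam P s i = las i) \<and>
          (\<forall>j\<in>edges P. mu P s j = mus j))"

text \<open>
  The control \<open>U\<close>, producing the state trajectory \<open>x\<close> from \<open>s0\<close>, is stabilizing. Since an arbitrary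
  control need not determine a unique trajectory, admissibility, cost and optimality refer to the
  pair of the control and a trajectory it produces.
\<close>

definition stabilizing ::
  "('v, 'e) pd_system \<Rightarrow> ('v, 'e) state \<Rightarrow> ('v \<Rightarrow> real) \<Rightarrow> ('v \<Rightarrow> real) \<Rightarrow> ('e \<Rightarrow> real)
     \<Rightarrow> ('v, 'e) control \<Rightarrow> (real \<Rightarrow> ('v, 'e) state) \<Rightarrow> bool" where
  "stabilizing P s0 ths las mus U x \<longleftrightarrow>
     causal U \<and> trajectory P s0 U x \<and> measurable_input P (\<lambda>t. U t x) \<and>
     converges_to_optimum P ths las mus x"


subsection \<open>The optimal control problem\<close>

definition R_xi :: "('v, 'e) pd_system \<Rightarrow> 'v \<Rightarrow> nat \<Rightarrow> real" where
  "R_xi P i k = 1 / 2 * (1 / (a_xi P i k * b_xi P i k))"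

definition R_tau :: "('v, 'e) pd_system \<Rightarrow> 'v \<Rightarrow> nat \<Rightarrow> real" where
  "R_tau P i k = 1 / 2 * (1 / (a_tau P i k * b_tau P i k))"

definition R_zeta :: "('v, 'e) pd_system \<Rightarrow> 'e \<Rightarrow> nat \<Rightarrow> real" where
  "R_zeta P j k = 1 / 2 * (1 / (a_zeta P j k * b_zeta P j k))"

text \<open>The quadratic form \<open>U\<^sup>T R U\<close> of the block-diagonal, diagonal matrix \<open>R\<close>.\<close>

definition R_norm_sq :: "('v, 'e) pd_system \<Rightarrow> ('v, 'e) inp \<Rightarrow> real" where
  "R_norm_sq P u =
     (\<Sum>i\<in>nodes P. \<Sum>k=2..rho_xi P i. R_xi P i k * (u_xi u i k)\<^sup>2) +
     (\<Sum>i\<in>nodes P. \<Sum>k=2..rho_tau P i. R_tau P i k * (u_tau u i k)\<^sup>2) +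
     (\<Sum>j\<in>edges P. \<Sum>k=2..rho_zeta P j. R_zeta P j k * (u_zeta u j k)\<^sup>2)"

definition q_xi ::
  "('v, 'e) pd_system \<Rightarrow> ('v \<Rightarrow> real) \<Rightarrow> ('v \<Rightarrow> real) \<Rightarrow> ('v, 'e) state \<Rightarrow> 'v \<Rightarrow> real" where
  "q_xi P ths las s i =
     (theta P s i - ths i) * (deriv (obj P i) (theta P s i) - deriv (obj P i) (ths i)) +
     (theta P s i - ths i) * (eta P s i - deriv (con P i) (ths i) * las i) +
     (\<Sum>k=2..rho_xi P i. a_xi P i k / (2 * b_xi P i k) * (xi s i k)\<^sup>2)"

definition q_tau ::
  "('v, 'e) pd_system \<Rightarrow> ('v \<Rightarrow> real) \<Rightarrow> ('v, 'e) state \<Rightarrow> 'v \<Rightarrow> real" where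
  "q_tau P las s i =
     - (tau s i 1 - las i) * pos_proj (con P i (theta P s i)) (tau s i 1)
     - (\<Sum>k=2..rho_tau P i. tau s i k * con P i (theta P s i))
     + (\<Sum>k=2..rho_tau P i. a_tau P i k / (2 * b_tau P i k) * (tau s i k)\<^sup>2)"

definition q_zeta :: "('v, 'e) pd_system \<Rightarrow> ('v, 'e) state \<Rightarrow> 'e \<Rightarrow> real" where
  "q_zeta P s j = (\<Sum>k=2..rho_zeta P j. a_zeta P j k / (2 * b_zeta P j k) * (zeta s j k)\<^sup>2)"

definition running_cost ::
  "('v, 'e) pd_system \<Rightarrow> ('v \<Rightarrow> real) \<Rightarrow> ('v \<Rightarrow> real) \<Rightarrow> ('v, 'e) state \<Rightarrow> ('v, 'e) inp \<Rightarrow> real" where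
  "running_cost P ths las s u =
     R_norm_sq P u + (\<Sum>i\<in>nodes P. q_xi P ths las s i) + (\<Sum>i\<in>nodes P. q_tau P las s i)
       + (\<Sum>j\<in>edges P. q_zeta P s j)"

text \<open>
  The Lebesgue integral over \<open>[0, \<infinity>)\<close> with values in the extended reals, as the difference of the
  integrals of the positive and the negative part; a control may have infinite cost.
\<close>

definition ext_integral :: "(real \<Rightarrow> real) \<Rightarrow> ereal" where
  "ext_integral f =
     enn2ereal (\<integral>\<^sup>+ t. ennreal (f t) \<partial>lebesgue_on {0..})
     - enn2ereal (\<integral>\<^sup>+ t. ennreal (- f t) \<partial>lebesgue_on {0..})"

definition cost ::
  "('v, 'e) pd_system \<Rightarrow> ('v \<Rightarrow> real) \<Rightarrow> ('v \<Rightarrow> real)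
     \<Rightarrow> ('v, 'e) control \<Rightarrow> (real \<Rightarrow> ('v, 'e) state) \<Rightarrow> ereal" where
  "cost P ths las U x = ext_integral (\<lambda>t. running_cost P ths las (x t) (U t x))"

definition optimal_control ::
  "('v, 'e) pd_system \<Rightarrow> ('v, 'e) state \<Rightarrow> ('v \<Rightarrow> real) \<Rightarrow> ('v \<Rightarrow> real) \<Rightarrow> ('e \<Rightarrow> real)
     \<Rightarrow> ('v, 'e) control \<Rightarrow> (real \<Rightarrow> ('v, 'e) state) \<Rightarrow> bool" where
  "optimal_control P s0 ths las mus U x \<longleftrightarrow>
     stabilizing P s0 ths las mus U x \<and>
     (\<forall>W y. stabilizing P s0 ths las mus W y \<longrightarrow> cost P ths las U x \<le> cost P ths las W y)"

definition apd_control :: "('v, 'e) pd_system \<Rightarrow> ('v, 'e) control" where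
  "apd_control P t x =
     \<lparr>u_xi = (\<lambda>i k. - a_xi P i k * xi (x t) i k),
      u_tau = (\<lambda>i k. - a_tau P i k * tau (x t) i k),
      u_zeta = (\<lambda>j k. - a_zeta P j k * zeta (x t) j k)\<rparr>"

definition same_input :: "('v, 'e) pd_system \<Rightarrow> ('v, 'e) inp \<Rightarrow> ('v, 'e) inp \<Rightarrow> bool" where
  "same_input P u v \<longleftrightarrow>
     (\<forall>i\<in>nodes P. \<forall>k\<in>{2..rho_xi P i}. u_xi u i k = u_xi v i k) \<and>
     (\<forall>i\<in>nodes P. \<forall>k\<in>{2..rho_tau P i}. u_tau u i k = u_tau v i k) \<and>
     (\<forall>j\<in>edges P. \<forall>k\<in>{2..rho_zeta P j}. u_zeta u j k = u_zeta v j k)"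

end

theory Submission
  imports Defs
begin

text \<open>
  Let \<open>V\<close> be the weighted squared distance of the state to the point with first components
  \<open>(\<theta>\<^sup>*, \<lambda>\<^sup>*, \<mu>\<^sup>*)\<close> and all further components \<open>0\<close>, with weights \<open>1 / (2 b)\<close>. By the KKT conditions and
  completion of squares, the running cost equals \<open>- dV/dt\<close> plus the squared \<open>R\<close>-norm of \<open>U\<close> minus
  the primal-dual feedback. Integrating, the cost is \<open>V(0) - V(\<infinity>)\<close> plus the integral of that square.

  The equilibrium reached by a stabilizing input may have nonzero components of index \<open>k \<ge> 2\<close>, so
  \<open>V(\<infinity>) = 0\<close> is not automatic. But resting at such an equilibrium requires an input that keeps
  away from the feedback, so the integral of the square diverges. By convexity the running cost is
  nonnegative, so such an input has infinite cost. Any other stabilizing input costs at least \<open>V(0)\<close>,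
  with equality only for the feedback.
\<close>

subsection \<open>Caratheodory solutions\<close>

lemma caratheodory_solutionD:
  assumes "caratheodory_solution f y y0" "0 \<le> t"
  shows "f absolutely_integrable_on {0..t}" "y t = y0 + integral {0..t} f"
  using assms by (auto simp: caratheodory_solution_def)

lemma caratheodory_solution_0:
  assumes "caratheodory_solution f y y0"
  shows "y 0 = y0"
  using caratheodory_solutionD(2)[OF assms, of 0] by simp

lemma caratheodory_solution_diff:
  assumes "caratheodory_solution f y y0" "0 \<le> s" "s \<le> t"
  shows "f absolutely_integrable_on {s..t}" "y t - y s = integral {s..t} f"
proof -
  have f: "f absolutely_integrable_on {0..t}"
    using assms by (intro caratheodory_solutionD) auto
  then show "f absolutely_integrable_on {s..t}"
    by (rule absolutely_integrable_on_subinterval) (use assms in auto)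
  have "integral {0..s} f + integral {s..t} f = integral {0..t} f"
    using assms set_lebesgue_integral_eq_integral(1)[OF f]
    by (intro Henstock_Kurzweil_Integration.integral_combine) auto
  then show "y t - y s = integral {s..t} f"
    using caratheodory_solutionD(2)[OF assms(1)] assms by force
qed

lemma caratheodory_solution_continuous_on:
  assumes "caratheodory_solution f y y0"
  shows "continuous_on {0..} y"
proof -
  have cont: "continuous_on {0..T} y" if "0 \<le> T" for T
  proof -
    have "f integrable_on {0..T}"
      using caratheodory_solutionD(1)[OF assms that] set_lebesgue_integral_eq_integral(1) by blast
    then have "continuous_on {0..T} (\<lambda>t. y0 + integral {0..t} f)"
      by (intro continuous_intros indefinite_integral_continuous_1)
    then show ?thesis
      by (rule continuous_on_eq) (use caratheodory_solutionD(2)[OF assms] in auto)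
  qed
  show ?thesis
    unfolding continuous_on_eq_continuous_within
  proof
    fix t :: real assume t: "t \<in> {0..}"
    have "continuous (at t within {0..t+1}) y"
      using cont[of "t+1"] t by (auto simp: continuous_on_eq_continuous_within)
    \<comment> \<open>Continuity is local: inside the neighbourhood \<open>{..<t+1}\<close> the ray
      and the compact interval agree, so the result on compact intervals carries over.\<close>
    moreover have "at t within {0..t+1} = at t within {0..}"
      by (rule at_within_nhd[of t "{..<t+1}"]) auto
    ultimately show "continuous (at t within {0..}) y"
      by simp
  qed
qed

text \<open>
  The increment of \<open>y\<^sup>2\<close> over \<open>{s..t}\<close> is \<open>y s + y t\<close> times the integral of \<open>f\<close>. On intervals so
  short that \<open>y\<close> oscillates by less than \<open>\<epsilon>\<close>, it differs from the integral of \<open>2 * y * f\<close> by at most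
  \<open>2 * \<epsilon>\<close> times the integral of \<open>\<bar>f\<bar>\<close>.
\<close>

lemma caratheodory_solution_square:
  assumes sol: "caratheodory_solution f y y0"
  shows "caratheodory_solution (\<lambda>t. 2 * y t * f t) (\<lambda>t. (y t)\<^sup>2) (y0\<^sup>2)"
  unfolding caratheodory_solution_def
proof (intro allI impI)
  fix T :: real assume T: "0 \<le> T"
  have cont: "continuous_on {0..T} y"
    using caratheodory_solution_continuous_on[OF sol] by (rule continuous_on_subset) auto
  have yf: "(\<lambda>t. 2 * y t * f t) absolutely_integrable_on {0..T}"
  proof (rule absolutely_integrable_bounded_measurable_product_real)
    show "(\<lambda>t. 2 * y t) \<in> borel_measurable (lebesgue_on {0..T})"
      using cont by (intro continuous_imp_measurable_on_sets_lebesgue continuous_intros) auto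
    show "bounded ((\<lambda>t. 2 * y t) ` {0..T})"
      using cont by (intro compact_imp_bounded compact_continuous_image continuous_intros) auto
  qed (use caratheodory_solutionD(1)[OF sol T] in auto)
  \<comment> \<open>\<open>h\<close> is the defect of the claimed identity up to its initial value;
    the goal is that it does not change between 0 and \<open>T\<close>.\<close>
  define h where "h t = (y t)\<^sup>2 - integral {0..t} (\<lambda>t. 2 * y t * f t)" for t
  define A where "A t = integral {0..t} (\<lambda>t. \<bar>f t\<bar>)" for t
  have absf: "(\<lambda>t. \<bar>f t\<bar>) integrable_on {0..T}"
    using caratheodory_solutionD(1)[OF sol T] by (simp add: absolutely_integrable_on_def)
  have step: "\<bar>h t - h s\<bar> \<le> 2 * e * (A t - A s)"
    if st: "0 \<le> s" "s \<le> t" "t \<le> T"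
      and osc: "\<And>r r'. r \<in> {s..t} \<Longrightarrow> r' \<in> {s..t} \<Longrightarrow> \<bar>y r - y r'\<bar> \<le> e" for s t e
  proof -
    have f: "f integrable_on {s..t}"
      using caratheodory_solution_diff(1)[OF sol] st set_lebesgue_integral_eq_integral(1) by blast
    have absf': "(\<lambda>t. \<bar>f t\<bar>) integrable_on {s..t}"
      using absf by (rule integrable_on_subinterval) (use st in auto)
    have yf': "(\<lambda>t. 2 * y t * f t) integrable_on {0..t}"
      using set_lebesgue_integral_eq_integral(1)[OF yf]
      by (rule integrable_on_subinterval) (use st in auto)
    then have yf'': "(\<lambda>t. 2 * y t * f t) integrable_on {s..t}"
      by (rule integrable_on_subinterval) (use st in auto)
    have "(\<lambda>t. \<bar>f t\<bar>) integrable_on {0..t}"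
      using absf by (rule integrable_on_subinterval) (use st in auto)
    then have "A s + integral {s..t} (\<lambda>t. \<bar>f t\<bar>) = A t"
      unfolding A_def using st by (intro Henstock_Kurzweil_Integration.integral_combine)
    then have Ast: "A t - A s = integral {s..t} (\<lambda>t. \<bar>f t\<bar>)"
      by simp
    have "integral {0..s} (\<lambda>t. 2 * y t * f t) + integral {s..t} (\<lambda>t. 2 * y t * f t)
        = integral {0..t} (\<lambda>t. 2 * y t * f t)"
      using st yf' by (intro Henstock_Kurzweil_Integration.integral_combine)
    \<comment> \<open>The difference of squares factors, and the factor \<open>y t - y s\<close> is
      the integral of \<open>f\<close>. This allows a comparison under a single integral.\<close>
    then have "h t - h s = (y t + y s) * (y t - y s) - integral {s..t} (\<lambda>r. 2 * y r * f r)"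
      unfolding h_def by (simp add: power2_eq_square algebra_simps)
    also have "\<dots> = integral {s..t} (\<lambda>r. (y t + y s) * f r) - integral {s..t} (\<lambda>r. 2 * y r * f r)"
      using caratheodory_solution_diff(2)[OF sol] st by simp
    also have "\<dots> = integral {s..t} (\<lambda>r. (y t + y s) * f r - 2 * y r * f r)"
      using f yf'' by (intro Henstock_Kurzweil_Integration.integral_diff[symmetric] integrable_on_mult_right)
    finally have hst: "h t - h s = integral {s..t} (\<lambda>r. (y t + y s) * f r - 2 * y r * f r)" .
    have "norm (integral {s..t} (\<lambda>r. (y t + y s) * f r - 2 * y r * f r))
        \<le> integral {s..t} (\<lambda>r. 2 * e * \<bar>f r\<bar>)"
    proof (rule Henstock_Kurzweil_Integration.integral_norm_bound_integral)
      fix r assume r: "r \<in> {s..t}"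
      have "(y t + y s) * f r - 2 * y r * f r = ((y t - y r) + (y s - y r)) * f r"
        by (simp add: algebra_simps)
      moreover have "\<bar>(y t - y r) + (y s - y r)\<bar> \<le> 2 * e"
        using osc[of t r] osc[of s r] r st by auto
      ultimately show "norm ((y t + y s) * f r - 2 * y r * f r) \<le> 2 * e * \<bar>f r\<bar>"
        by (simp add: abs_mult mult_right_mono)
    qed (use f yf'' absf' in \<open>auto intro!: integrable_diff integrable_on_mult_right\<close>)
    then show ?thesis
      using hst Ast by simp
  qed
  have "\<bar>h T - h 0\<bar> \<le> 2 * e * A T" if e: "0 < e" for e
  proof -
    have "uniformly_continuous_on {0..T} y"
      using cont by (simp add: compact_uniformly_continuous)
    then obtain d where d: "0 < d"
      and osc: "\<And>r r'. r \<in> {0..T} \<Longrightarrow> r' \<in> {0..T} \<Longrightarrow> \<bar>r - r'\<bar> < d \<Longrightarrow> \<bar>y r - y r'\<bar> < e"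
      unfolding uniformly_continuous_on_def dist_real_def using e by metis
    \<comment> \<open>A uniform partition into \<open>n\<close> pieces has mesh
      \<open>T / n < d\<close>. The strict inequality forces \<open>n\<close> to be positive even
      for \<open>T = 0\<close>.\<close>
    obtain n :: nat where n: "T / d < real n"
      using reals_Archimedean2 by blast
    have npos: "0 < real n"
      using n T d by (meson divide_nonneg_pos le_less_trans)
    define p where "p k = T * real k / real n" for k
    have p0: "p 0 = 0" and pn: "p n = T"
      using npos by (simp_all add: p_def)
    have pSuc: "p (Suc k) - p k = T / n" for k
      by (simp add: p_def diff_divide_distrib[symmetric] algebra_simps)
    have small: "T / n < d"
      using n d npos by (simp add: field_simps)
    have "\<bar>h (p (Suc k)) - h (p k)\<bar> \<le> 2 * e * (A (p (Suc k)) - A (p k))" if k: "k < n" for k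
    proof (rule step)
      show "0 \<le> p k" "p k \<le> p (Suc k)"
        using T by (auto simp: p_def divide_right_mono mult_left_mono)
      have "real (Suc k) \<le> real n" using k by linarith
      then have "T * real (Suc k) \<le> T * real n"
        using T by (intro mult_left_mono) auto
      then show le: "p (Suc k) \<le> T"
        using npos by (simp add: p_def divide_le_eq)
      show "\<bar>y r - y r'\<bar> \<le> e" if "r \<in> {p k..p (Suc k)}" "r' \<in> {p k..p (Suc k)}" for r r'
        using that osc[of r r'] \<open>0 \<le> p k\<close> le pSuc[of k] small by fastforce
    qed
    then have "(\<Sum>k<n. \<bar>h (p (Suc k)) - h (p k)\<bar>) \<le> (\<Sum>k<n. 2 * e * (A (p (Suc k)) - A (p k)))"
      by (intro sum_mono) auto
    also have "\<dots> = 2 * e * (A T - A 0)"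
      using sum_lessThan_telescope[of "\<lambda>k. A (p k)" n] by (simp flip: sum_distrib_left add: p0 pn)
    finally have "(\<Sum>k<n. \<bar>h (p (Suc k)) - h (p k)\<bar>) \<le> 2 * e * A T"
      by (simp add: A_def)
    moreover have "\<bar>h T - h 0\<bar> \<le> (\<Sum>k<n. \<bar>h (p (Suc k)) - h (p k)\<bar>)"
      using sum_lessThan_telescope[of "\<lambda>k. h (p k)" n] sum_abs[of "\<lambda>k. h (p (Suc k)) - h (p k)" "{..<n}"]
      by (simp add: p0 pn)
    ultimately show ?thesis
      by simp
  qed
  \<comment> \<open>The previous estimate is used with tolerance \<open>e / (2 * (A T + 1))\<close>;
    the added 1 keeps the denominator positive when \<open>A T = 0\<close>.\<close>
  then have lim: "\<bar>h T - h 0\<bar> \<le> e" if "0 < e" for e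
  proof -
    have A: "0 \<le> A T"
      unfolding A_def using absf by (intro Henstock_Kurzweil_Integration.integral_nonneg) auto
    then have "2 * (e / (2 * (A T + 1))) * A T = e * (A T / (A T + 1))"
      by (simp add: field_simps)
    also have "\<dots> \<le> e * 1"
      using A that by (intro mult_left_mono) auto
    finally show ?thesis
      using \<open>\<And>e. 0 < e \<Longrightarrow> \<bar>h T - h 0\<bar> \<le> 2 * e * A T\<close>[of "e / (2 * (A T + 1))"] A that by simp
  qed
  \<comment> \<open>A nonzero defect would be at most half of itself.\<close>
  have "h T = h 0"
    using lim[of "\<bar>h T - h 0\<bar> / 2"] by force
  then have "(y T)\<^sup>2 = y0\<^sup>2 + integral {0..T} (\<lambda>t. 2 * y t * f t)"
    by (simp add: h_def caratheodory_solution_0[OF sol])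
  with yf show "(\<lambda>t. 2 * y t * f t) absolutely_integrable_on {0..T} \<and>
      (y T)\<^sup>2 = y0\<^sup>2 + integral {0..T} (\<lambda>t. 2 * y t * f t)"
    by simp
qed

lemma caratheodory_solution_diff_const:
  assumes "caratheodory_solution f y y0"
  shows "caratheodory_solution f (\<lambda>t. y t - c) (y0 - c)"
  using assms by (auto simp: caratheodory_solution_def)

lemma caratheodory_solution_cmult:
  assumes "caratheodory_solution f y y0"
  shows "caratheodory_solution (\<lambda>t. c * f t) (\<lambda>t. c * y t) (c * y0)"
  using assms by (auto simp: caratheodory_solution_def algebra_simps)

lemma caratheodory_solution_add:
  assumes "caratheodory_solution f y y0" "caratheodory_solution g z z0"
  shows "caratheodory_solution (\<lambda>t. f t + g t) (\<lambda>t. y t + z t) (y0 + z0)"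
  using assms
  by (auto simp: caratheodory_solution_def
      Henstock_Kurzweil_Integration.integral_add[OF set_lebesgue_integral_eq_integral(1) set_lebesgue_integral_eq_integral(1)])

lemma caratheodory_solution_sum:
  assumes "finite I" "\<And>i. i \<in> I \<Longrightarrow> caratheodory_solution (\<lambda>t. f i t) (\<lambda>t. y i t) (y0 i)"
  shows "caratheodory_solution (\<lambda>t. \<Sum>i\<in>I. f i t) (\<lambda>t. \<Sum>i\<in>I. y i t) (\<Sum>i\<in>I. y0 i)"
  using assms
proof (induction I)
  case empty
  then show ?case by (simp add: caratheodory_solution_def)
next
  case (insert i I)
  then show ?case by (auto intro: caratheodory_solution_add)
qed

lemma caratheodory_solution_weighted_square:
  assumes "caratheodory_solution f y y0"
  shows "caratheodory_solution (\<lambda>t. (y t - c) / b * f t) (\<lambda>t. (y t - c)\<^sup>2 / (2 * b)) ((y0 - c)\<^sup>2 / (2 * b))"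
proof -
  have "caratheodory_solution (\<lambda>t. 1 / (2 * b) * (2 * (y t - c) * f t))
      (\<lambda>t. 1 / (2 * b) * (y t - c)\<^sup>2) (1 / (2 * b) * (y0 - c)\<^sup>2)"
    by (intro caratheodory_solution_cmult caratheodory_solution_square caratheodory_solution_diff_const assms)
  \<comment> \<open>For \<open>b = 0\<close> both sides are 0, because division by zero is
    0.\<close>
  moreover have "1 / (2 * b) * (2 * (y t - c) * f t) = (y t - c) / b * f t" for t
    by (cases "b = 0") (auto simp: field_simps)
  ultimately show ?thesis
    by simp
qed

text \<open>Only nonnegative times matter. Identities between cost and energy hold only there, since
  they rest on nonnegativity of \<open>tau\<close>, so this is how they are transferred to
  solutions.\<close>

lemma caratheodory_solution_cong:
  assumes "caratheodory_solution f y y0" "\<And>t. 0 \<le> t \<Longrightarrow> f t = g t"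
  shows "caratheodory_solution g y y0"
  unfolding caratheodory_solution_def
proof (intro allI impI)
  fix t :: real assume "0 \<le> t"
  moreover have "integral {0..t} f = integral {0..t} g"
    by (rule Henstock_Kurzweil_Integration.integral_cong) (use assms in auto)
  moreover have "f absolutely_integrable_on {0..t} \<longleftrightarrow> g absolutely_integrable_on {0..t}"
    by (rule set_integrable_cong) (use assms in auto)
  ultimately show "g absolutely_integrable_on {0..t} \<and> y t = y0 + integral {0..t} g"
    using assms(1) by (simp add: caratheodory_solution_def)
qed

section \<open>Limits of damped equations with finite-energy disturbances\<close>

text \<open>
  If the limit were positive, then the drift \<open>p t - a * y t\<close> would push \<open>y\<close> to \<open>-\<infinity>\<close>, since a
  disturbance \<open>w\<close> with finite energy can compensate it only to a finite amount.
\<close>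

lemma dissipative_limit_nonpos:
  fixes y :: "real \<Rightarrow> real"
  assumes sol: "caratheodory_solution f y y0"
    and y: "(y \<longlongrightarrow> c) at_top" and p: "(p \<longlongrightarrow> 0) at_top" and a: "0 < a"
    and f: "eventually (\<lambda>t. f t = p t - a * y t + w t) at_top"
    and w: "eventually (\<lambda>t. (w t)\<^sup>2 \<le> C * g t) at_top"
    and C: "0 \<le> C"
    and g: "\<And>t. 0 \<le> g t" "\<And>T. 0 \<le> T \<Longrightarrow> g integrable_on {0..T}" "\<And>T. 0 \<le> T \<Longrightarrow> integral {0..T} g \<le> K"
  shows "c \<le> 0"
proof (rule ccontr)
  assume "\<not> c \<le> 0"
  then have c: "0 < c" by simp
  \<comment> \<open>A quarter of the limiting damping: once \<open>y\<close> exceeds three quarters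
    of \<open>c\<close>, the damping is at least \<open>3 * m\<close>. One \<open>m\<close> is spent
    on \<open>p\<close>, one on the disturbance, and one remains as net decay.\<close>
  define m where "m = a * c / 4"
  have m: "0 < m" using a c by (simp add: m_def)
  have "eventually (\<lambda>t. y t > 3 / 4 * c) at_top"
    using y c by (intro order_tendstoD) auto
  moreover have "eventually (\<lambda>t. p t < m) at_top"
    using p m by (intro order_tendstoD) auto
  ultimately have "eventually (\<lambda>t. 0 < y t \<and> f t \<le> - m + C / (4 * m) * g t) at_top"
    using f w
  proof eventually_elim
    case (elim t)
    have "a * (3 / 4 * c) < a * y t"
      using elim(1) a by (intro mult_strict_left_mono)
    then have "3 * m < a * y t" by (simp add: m_def)
    \<comment> \<open>Young's inequality trades the disturbance for the constant \<open>m\<close>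
      plus a multiple of its energy density.\<close>
    moreover have "0 \<le> (w t - 2 * m)\<^sup>2" by simp
    then have "4 * m * w t \<le> 4 * m\<^sup>2 + C * g t"
      using elim(4) by (simp add: power2_eq_square algebra_simps)
    then have "w t \<le> m + C * g t / (4 * m)"
      using m by (simp add: field_simps power2_eq_square)
    ultimately show ?case
      using elim c by (auto intro: less_trans[OF _ elim(1)])
  qed
  then obtain S0 where S0: "\<And>t. S0 \<le> t \<Longrightarrow> 0 < y t \<and> f t \<le> - m + C / (4 * m) * g t"
    by (auto simp: eventually_at_top_linorder)
  define S where "S = max S0 0"
  have S: "0 < y t" "f t \<le> - m + C / (4 * m) * g t" if "S \<le> t" for t
    using S0[of t] that by (auto simp: S_def)
  have S_nonneg: "0 \<le> S" by (simp add: S_def)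
  define D where "D = C / (4 * m) * K"
  have K: "0 \<le> K" using g(3)[of 0] by simp
  then have D: "0 \<le> D" using m C by (simp add: D_def)
  \<comment> \<open>At this time the accumulated decay \<open>m * (T - S)\<close> equals
    \<open>y S + D\<close>, which exhausts the value at \<open>S\<close> and the whole energy budget
    \<open>D\<close>. So \<open>y T\<close> cannot be positive.\<close>
  define T where "T = S + (y S + D) / m"
  have "0 < y S" using S(1) by simp
  then have ST: "S \<le> T" using m D by (simp add: T_def)
  have gST: "g integrable_on {S..T}"
    using g(2)[of T] by (rule integrable_on_subinterval) (use ST S_nonneg in auto)
  have "integral {S..T} g \<le> integral {0..T} g"
    using gST g ST S_nonneg by (intro integral_subset_le) auto
  then have gK: "integral {S..T} g \<le> K"
    using g(3)[of T] ST S_nonneg by simp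
  have "y T - y S = integral {S..T} f"
    using sol S_nonneg ST by (rule caratheodory_solution_diff)
  also have "\<dots> \<le> integral {S..T} (\<lambda>t. - m + C / (4 * m) * g t)"
    using set_lebesgue_integral_eq_integral(1)[OF caratheodory_solution_diff(1)[OF sol S_nonneg ST]] gST S(2)
    by (intro integral_le integrable_add integrable_on_mult_right) auto
  also have "\<dots> = - m * (T - S) + C / (4 * m) * integral {S..T} g"
    using ST integrable_on_mult_right[OF gST, of "C / (4 * m)"]
    by (subst Henstock_Kurzweil_Integration.integral_add) (auto simp: algebra_simps)
  also have "\<dots> \<le> - m * (T - S) + D"
    unfolding D_def using gK m C by (intro add_left_mono mult_left_mono) auto
  also have "\<dots> = - y S"
    using m by (simp add: T_def)
  finally show False
    using S(1)[OF ST] by simp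
qed

text \<open>The one-sided bound applies to \<open>y\<close> and to its negative, since the
  disturbance hypothesis only sees the square of \<open>w\<close>.\<close>

lemma dissipative_limit_zero:
  fixes y :: "real \<Rightarrow> real"
  assumes sol: "caratheodory_solution f y y0"
    and y: "(y \<longlongrightarrow> c) at_top" and p: "(p \<longlongrightarrow> 0) at_top" and a: "0 < a"
    and f: "eventually (\<lambda>t. f t = p t - a * y t + w t) at_top"
    and w: "eventually (\<lambda>t. (w t)\<^sup>2 \<le> C * g t) at_top"
    and C: "0 \<le> C"
    and g: "\<And>t. 0 \<le> g t" "\<And>T. 0 \<le> T \<Longrightarrow> g integrable_on {0..T}" "\<And>T. 0 \<le> T \<Longrightarrow> integral {0..T} g \<le> K"
  shows "c = 0"
proof -
  have "- c \<le> 0"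
  proof (rule dissipative_limit_nonpos)
    show "caratheodory_solution (\<lambda>t. - f t) (\<lambda>t. - y t) (- y0)"
      using caratheodory_solution_cmult[OF sol, of "- 1"] by simp
    show "((\<lambda>t. - y t) \<longlongrightarrow> - c) at_top" "((\<lambda>t. - p t) \<longlongrightarrow> 0) at_top"
      using tendsto_minus[OF y] tendsto_minus[OF p] by auto
    show "eventually (\<lambda>t. - f t = - p t - a * - y t + - w t) at_top"
      using f by eventually_elim simp
    show "eventually (\<lambda>t. (- w t)\<^sup>2 \<le> C * g t) at_top"
      using w by simp
  qed (fact a C g)+
  then show ?thesis
    using dissipative_limit_nonpos[OF assms] by simp
qed

subsection \<open>Integrals over a half-line\<close>

text \<open>Monotone convergence along the intervals \<open>{a..real n}\<close>. It connects the
  cost, a Lebesgue integral with values up to infinity, with the gauge integrals in the energy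
  balance.\<close>

lemma nn_integral_atLeast_eq_SUP:
  fixes f :: "real \<Rightarrow> real"
  assumes nonneg: "\<And>t. a \<le> t \<Longrightarrow> 0 \<le> f t" and int: "\<And>T. f integrable_on {a..T}"
  shows "(\<integral>\<^sup>+ t. ennreal (f t) \<partial>lebesgue_on {a..}) = (SUP n. ennreal (integral {a..real n} f))"
proof -
  have "(\<integral>\<^sup>+ t. ennreal (f t) \<partial>lebesgue_on {a..}) = (\<integral>\<^sup>+ t. ennreal (f t) * indicator {a..} t \<partial>lebesgue)"
    by (rule nn_integral_restrict_space) simp
  also have "\<dots> = (\<integral>\<^sup>+ t. (SUP n. ennreal (f t) * indicator {a..real n} t) \<partial>lebesgue)"
  proof (rule nn_integral_cong)
    fix t
    obtain n :: nat where n: "t \<le> real n"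
      using real_arch_simple by blast
    have "ennreal (f t) * indicator {a..} t \<le> (SUP n. ennreal (f t) * indicator {a..real n} t)"
      by (rule SUP_upper2[of n]) (use n in \<open>auto simp: indicator_def\<close>)
    moreover have "(SUP n. ennreal (f t) * indicator {a..real n} t) \<le> ennreal (f t) * indicator {a..} t"
      by (rule SUP_least) (auto simp: indicator_def)
    ultimately show "ennreal (f t) * indicator {a..} t = (SUP n. ennreal (f t) * indicator {a..real n} t)"
      by (rule antisym)
  qed
  also have "\<dots> = (SUP n. \<integral>\<^sup>+ t. ennreal (f t) * indicator {a..real n} t \<partial>lebesgue)"
  proof (rule nn_integral_monotone_convergence_SUP)
    show "incseq (\<lambda>n t. ennreal (f t) * indicator {a..real n} t)"
      by (auto simp: incseq_def le_fun_def indicator_def)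
    fix n
    \<comment> \<open>For a nonnegative function gauge integrability is absolute, which supplies
      Lebesgue measurability.\<close>
    have "f absolutely_integrable_on {a..real n}"
      using int nonneg by (intro nonnegative_absolutely_integrable_1) auto
    then have "(\<lambda>t. ennreal (indicat_real {a..real n} t *\<^sub>R f t)) \<in> borel_measurable lebesgue"
      by (auto simp: set_integrable_def)
    also have "(\<lambda>t. ennreal (indicat_real {a..real n} t *\<^sub>R f t)) = (\<lambda>t. ennreal (f t) * indicator {a..real n} t)"
      by (auto simp: indicator_def)
    finally show "(\<lambda>t. ennreal (f t) * indicator {a..real n} t) \<in> borel_measurable lebesgue" .
  qed
  also have "\<dots> = (SUP n. ennreal (integral {a..real n} f))"
    using nn_integral_has_integral_lebesgue'[OF _ integrable_integral[OF int]] nonneg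
    by (simp add: nn_integral_completion)
  finally show ?thesis .
qed

text \<open>The integral over the compact interval is dominated by the one over the half-line.
  Finite cost thus makes the running cost integrable on compact intervals.\<close>

lemma integrable_on_Icc_if_nn_integral_finite:
  fixes f :: "real \<Rightarrow> real"
  assumes nonneg: "\<And>t. a \<le> t \<Longrightarrow> 0 \<le> f t"
    and meas: "f \<in> borel_measurable (lebesgue_on {a..T})"
    and fin: "(\<integral>\<^sup>+ t. ennreal (f t) \<partial>lebesgue_on {a..}) < \<infinity>"
  shows "f integrable_on {a..T}"
proof -
  have "(\<integral>\<^sup>+ t. ennreal (norm (f t)) \<partial>lebesgue_on {a..T}) = (\<integral>\<^sup>+ t. ennreal (f t) * indicator {a..T} t \<partial>lebesgue)"
    using nonneg by (subst nn_integral_restrict_space) (auto intro!: nn_integral_cong simp: indicator_def)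
  also have "\<dots> \<le> (\<integral>\<^sup>+ t. ennreal (f t) * indicator {a..} t \<partial>lebesgue)"
    by (intro nn_integral_mono) (auto simp: indicator_def)
  also have "\<dots> = (\<integral>\<^sup>+ t. ennreal (f t) \<partial>lebesgue_on {a..})"
    by (subst nn_integral_restrict_space) auto
  finally have "integrable (lebesgue_on {a..T}) f"
    using fin meas by (intro integrableI_bounded) auto
  then show ?thesis
    by (rule integrable_on_lebesgue_on) simp
qed

text \<open>The negative part vanishes because \<open>ennreal\<close> sends nonpositive numbers to
  0.\<close>

lemma ext_integral_nonneg:
  assumes "\<And>t. 0 \<le> t \<Longrightarrow> 0 \<le> f t"
  shows "ext_integral f = enn2ereal (\<integral>\<^sup>+ t. ennreal (f t) \<partial>lebesgue_on {0..})"
proof -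
  have "(\<integral>\<^sup>+ t. ennreal (- f t) \<partial>lebesgue_on {0..}) = (\<integral>\<^sup>+ t. 0 \<partial>lebesgue_on {0::real..})"
    by (rule nn_integral_cong) (use assms in \<open>auto simp: ennreal_neg\<close>)
  then show ?thesis
    by (simp add: ext_integral_def zero_ennreal.rep_eq)
qed

subsection \<open>Smooth convex functions\<close>

lemma smooth_convexD:
  assumes "smooth_convex f"
  shows "(f has_real_derivative deriv f x) (at x)"
    and "continuous_on UNIV (deriv f)"
    and "deriv f x * (y - x) \<le> f y - f x"
proof -
  obtain D where D: "\<And>x. (f has_vector_derivative D x) (at x)" "continuous_on UNIV D"
    using assms by (auto simp: smooth_convex_def C1_differentiable_on_def)
  then have D': "(f has_real_derivative D x) (at x)" for x
    by (simp add: has_real_derivative_iff_has_vector_derivative)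
  then have "deriv f = D"
    by (auto simp: DERIV_imp_deriv)
  with D D' show *: "(f has_real_derivative deriv f x) (at x)" and "continuous_on UNIV (deriv f)"
    by auto
  show "deriv f x * (y - x) \<le> f y - f x"
    by (rule convex_on_imp_above_tangent[of UNIV f x y]) (use assms * in \<open>auto simp: smooth_convex_def\<close>)
qed

lemma smooth_convex_tendsto:
  assumes "smooth_convex f" "(g \<longlongrightarrow> c) F"
  shows "((\<lambda>t. f (g t)) \<longlongrightarrow> f c) F" "((\<lambda>t. deriv f (g t)) \<longlongrightarrow> deriv f c) F"
proof -
  have "isCont f c"
    using smooth_convexD(1)[OF assms(1)] by (rule DERIV_isCont)
  then show "((\<lambda>t. f (g t)) \<longlongrightarrow> f c) F"
    using assms(2) by (rule isCont_tendsto_compose)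
  have "isCont (deriv f) c"
    using smooth_convexD(2)[OF assms(1)] by (simp add: continuous_on_eq_continuous_at)
  then show "((\<lambda>t. deriv f (g t)) \<longlongrightarrow> deriv f c) F"
    using assms(2) by (rule isCont_tendsto_compose)
qed

text \<open>Sum of the tangent inequalities at \<open>x\<close> and at \<open>y\<close>.\<close>

lemma smooth_convex_deriv_mono:
  assumes "smooth_convex f"
  shows "0 \<le> (x - y) * (deriv f x - deriv f y)"
  using smooth_convexD(3)[OF assms, of x y] smooth_convexD(3)[OF assms, of y x]
  by (simp add: algebra_simps)

subsection \<open>Energy balance\<close>

definition target :: "real \<Rightarrow> nat \<Rightarrow> real" where
  "target c k = (if k = 1 then c else 0)"

text \<open>The weight \<open>1 / b k\<close> cancels the gain of the common drive \<open>f\<close>,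
  so the deviations add up to that of the sum. The input acts only for \<open>k\<close> at least 2,
  where the target is 0.\<close>

lemma block_power:
  assumes n: "1 \<le> n" and b: "\<And>k. k \<in> {1..n} \<Longrightarrow> 0 < b k"
  shows "(\<Sum>k=1..n. (x k - target c k) / b k * (b k * f + embed_input u k))
    = ((\<Sum>k=1..n. x k) - c) * f + (\<Sum>k=2..n. x k * u k / b k)"
proof -
  have "(\<Sum>k=1..n. (x k - target c k) / b k * (b k * f + embed_input u k))
    = (\<Sum>k=1..n. (x k - target c k) * f + (x k - target c k) * embed_input u k / b k)"
    by (rule sum.cong[OF refl]) (use b in \<open>force simp: field_simps\<close>)
  also have "\<dots> = (\<Sum>k=1..n. x k - target c k) * f + (\<Sum>k=1..n. (x k - target c k) * embed_input u k / b k)"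
    by (simp add: sum.distrib sum_distrib_right)
  also have "(\<Sum>k=1..n. x k - target c k) = (\<Sum>k=1..n. x k) - c"
    using n by (simp add: sum_subtractf target_def)
  also have "(\<Sum>k=1..n. (x k - target c k) * embed_input u k / b k)
      = (\<Sum>k=2..n. (x k - target c k) * embed_input u k / b k)"
    using n by (simp add: sum.atLeast_Suc_atMost embed_input_def numeral_2_eq_2)
  also have "\<dots> = (\<Sum>k=2..n. x k * u k / b k)"
    by (rule sum.cong) (auto simp: target_def embed_input_def)
  finally show ?thesis .
qed

text \<open>For \<open>k\<close> at least 2 the projection disappears: either \<open>x k\<close> is
  positive and it is inactive, or \<open>x k = 0\<close> kills the product. In the first component
  the target may be nonzero, so the projection survives, as it does in \<open>q_tau\<close>.\<close>

lemma block_power_pos_proj: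
  assumes n: "1 \<le> n" and b: "\<And>k. k \<in> {1..n} \<Longrightarrow> 0 < b k" and x: "\<And>k. k \<in> {1..n} \<Longrightarrow> 0 \<le> x k"
  shows "(\<Sum>k=1..n. (x k - target c k) / b k * pos_proj (b k * f + embed_input u k) (x k))
    = (x 1 - c) * pos_proj f (x 1) + (\<Sum>k=2..n. x k * f) + (\<Sum>k=2..n. x k * u k / b k)"
proof -
  have "(\<Sum>k=1..n. (x k - target c k) / b k * pos_proj (b k * f + embed_input u k) (x k))
    = (x 1 - c) / b 1 * pos_proj (b 1 * f) (x 1)
      + (\<Sum>k=2..n. (x k - target c k) / b k * pos_proj (b k * f + embed_input u k) (x k))"
    using n by (simp add: sum.atLeast_Suc_atMost embed_input_def target_def numeral_2_eq_2)
  \<comment> \<open>The projection commutes with multiplication by the positive gain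
    \<open>b 1\<close>.\<close>
  also have "(x 1 - c) / b 1 * pos_proj (b 1 * f) (x 1) = (x 1 - c) * pos_proj f (x 1)"
    using b[of 1] n by (auto simp: pos_proj_def zero_le_mult_iff)
  also have "(\<Sum>k=2..n. (x k - target c k) / b k * pos_proj (b k * f + embed_input u k) (x k))
      = (\<Sum>k=2..n. x k * f + x k * u k / b k)"
  proof (rule sum.cong[OF refl])
    fix k assume "k \<in> {2..n}"
    then have k: "k \<noteq> 1" "0 < b k" "0 \<le> x k"
      using b[of k] x[of k] by auto
    then show "(x k - target c k) / b k * pos_proj (b k * f + embed_input u k) (x k) = x k * f + x k * u k / b k"
      by (cases "x k = 0") (auto simp: target_def embed_input_def pos_proj_def field_simps)
  qed
  finally show ?thesis
    by (simp add: sum.distrib)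
qed

text \<open>The cross term comes from \<open>block_power\<close>. The input and state weights are
  matched so that it completes the square exactly.\<close>

lemma block_complete_square:
  fixes a b u x :: "nat \<Rightarrow> real"
  assumes "\<And>k. k \<in> {2..n} \<Longrightarrow> 0 < a k" "\<And>k. k \<in> {2..n} \<Longrightarrow> 0 < b k"
  shows "(\<Sum>k=2..n. 1 / 2 * (1 / (a k * b k)) * (u k)\<^sup>2) + (\<Sum>k=2..n. a k / (2 * b k) * (x k)\<^sup>2)
      + (\<Sum>k=2..n. x k * u k / b k)
    = (\<Sum>k=2..n. 1 / 2 * (1 / (a k * b k)) * (u k + a k * x k)\<^sup>2)"
  unfolding sum.distrib[symmetric]
proof (rule sum.cong[OF refl])
  fix k assume "k \<in> {2..n}"
  then have "0 < a k" "0 < b k" using assms by auto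
  then show "1 / 2 * (1 / (a k * b k)) * (u k)\<^sup>2 + a k / (2 * b k) * (x k)\<^sup>2 + x k * u k / b k
      = 1 / 2 * (1 / (a k * b k)) * (u k + a k * x k)\<^sup>2"
    by (simp add: field_simps power2_eq_square)
qed

definition energy ::
  "('v, 'e) pd_system \<Rightarrow> ('v \<Rightarrow> real) \<Rightarrow> ('v \<Rightarrow> real) \<Rightarrow> ('e \<Rightarrow> real) \<Rightarrow> ('v, 'e) state \<Rightarrow> real" where
  "energy P ths las mus s =
     (\<Sum>i\<in>nodes P. \<Sum>k=1..rho_xi P i. (xi s i k - target (ths i) k)\<^sup>2 / (2 * b_xi P i k)) +
     (\<Sum>i\<in>nodes P. \<Sum>k=1..rho_tau P i. (tau s i k - target (las i) k)\<^sup>2 / (2 * b_tau P i k)) +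
     (\<Sum>j\<in>edges P. \<Sum>k=1..rho_zeta P j. (zeta s j k - target (mus j) k)\<^sup>2 / (2 * b_zeta P j k))"

definition energy_rate ::
  "('v, 'e) pd_system \<Rightarrow> ('v \<Rightarrow> real) \<Rightarrow> ('v \<Rightarrow> real) \<Rightarrow> ('e \<Rightarrow> real)
     \<Rightarrow> ('v, 'e) state \<Rightarrow> ('v, 'e) inp \<Rightarrow> real" where
  "energy_rate P ths las mus s u =
     (\<Sum>i\<in>nodes P. \<Sum>k=1..rho_xi P i.
        (xi s i k - target (ths i) k) / b_xi P i k * xi_field P s u i k) +
     (\<Sum>i\<in>nodes P. \<Sum>k=1..rho_tau P i.
        (tau s i k - target (las i) k) / b_tau P i k * tau_field P s u i k) +
     (\<Sum>j\<in>edges P. \<Sum>k=1..rho_zeta P j.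
        (zeta s j k - target (mus j) k) / b_zeta P j k * zeta_field P s u j k)"

definition deviation :: "('v, 'e) pd_system \<Rightarrow> ('v, 'e) state \<Rightarrow> ('v, 'e) inp \<Rightarrow> real" where
  "deviation P s u =
     (\<Sum>i\<in>nodes P. \<Sum>k=2..rho_xi P i. R_xi P i k * (u_xi u i k + a_xi P i k * xi s i k)\<^sup>2) +
     (\<Sum>i\<in>nodes P. \<Sum>k=2..rho_tau P i. R_tau P i k * (u_tau u i k + a_tau P i k * tau s i k)\<^sup>2) +
     (\<Sum>j\<in>edges P. \<Sum>k=2..rho_zeta P j. R_zeta P j k * (u_zeta u j k + a_zeta P j k * zeta s j k)\<^sup>2)"

lemma energy_along_trajectory:
  assumes "pd_setting P" "trajectory P s0 U x"
  shows "caratheodory_solution (\<lambda>t. energy_rate P ths las mus (x t) (U t x))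
    (\<lambda>t. energy P ths las mus (x t)) (energy P ths las mus s0)"
proof -
  have "finite (nodes P)" "finite (edges P)"
    using assms(1) by (auto simp: pd_setting_def fin_digraph_def fin_digraph_axioms_def)
  then show ?thesis
    using assms(2) unfolding energy_def energy_rate_def trajectory_def
    by (intro caratheodory_solution_add caratheodory_solution_sum caratheodory_solution_weighted_square) auto
qed

section \<open>Energy identity and cost bounds relative to a fixed KKT point\<close>

locale pd_optimum =
  fixes P :: "('v, 'e) pd_system" and ths las :: "'v \<Rightarrow> real" and mus :: "'e \<Rightarrow> real"
  assumes setting: "pd_setting P" and kkt: "kkt_point P ths las mus"
begin

lemma finite_network [simp]: "finite (nodes P)" "finite (edges P)"
  using setting by (auto simp: pd_setting_def fin_digraph_def fin_digraph_axioms_def)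

lemma smooth_convex:
  assumes "i \<in> nodes P"
  shows "smooth_convex (obj P i)" "smooth_convex (con P i)"
  using setting assms by (auto simp: pd_setting_def)

lemma rho_ge_1:
  shows "i \<in> nodes P \<Longrightarrow> 1 \<le> rho_xi P i" "i \<in> nodes P \<Longrightarrow> 1 \<le> rho_tau P i"
    "j \<in> edges P \<Longrightarrow> 1 \<le> rho_zeta P j"
  using setting by (auto simp: pd_setting_def)

lemma b_pos:
  shows "i \<in> nodes P \<Longrightarrow> k \<in> {1..rho_xi P i} \<Longrightarrow> 0 < b_xi P i k"
    "i \<in> nodes P \<Longrightarrow> k \<in> {1..rho_tau P i} \<Longrightarrow> 0 < b_tau P i k"
    "j \<in> edges P \<Longrightarrow> k \<in> {1..rho_zeta P j} \<Longrightarrow> 0 < b_zeta P j k"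
  using setting by (auto simp: pd_setting_def)

lemma a_pos:
  shows "i \<in> nodes P \<Longrightarrow> k \<in> {2..rho_xi P i} \<Longrightarrow> 0 < a_xi P i k"
    "i \<in> nodes P \<Longrightarrow> k \<in> {2..rho_tau P i} \<Longrightarrow> 0 < a_tau P i k"
    "j \<in> edges P \<Longrightarrow> k \<in> {2..rho_zeta P j} \<Longrightarrow> 0 < a_zeta P j k"
  using setting by (auto simp: pd_setting_def increasing_gains_def)

lemma R_pos:
  shows "i \<in> nodes P \<Longrightarrow> k \<in> {2..rho_xi P i} \<Longrightarrow> 0 < R_xi P i k"
    "i \<in> nodes P \<Longrightarrow> k \<in> {2..rho_tau P i} \<Longrightarrow> 0 < R_tau P i k"
    "j \<in> edges P \<Longrightarrow> k \<in> {2..rho_zeta P j} \<Longrightarrow> 0 < R_zeta P j k"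
  using a_pos b_pos by (auto simp: R_xi_def R_tau_def R_zeta_def)

lemma kktD:
  shows "i \<in> nodes P \<Longrightarrow> deriv (obj P i) (ths i) + deriv (con P i) (ths i) * las i + mat_mult P mus i = 0"
    "i \<in> nodes P \<Longrightarrow> las i * con P i (ths i) = 0"
    "i \<in> nodes P \<Longrightarrow> 0 \<le> las i"
    "i \<in> nodes P \<Longrightarrow> con P i (ths i) \<le> 0"
    "j \<in> edges P \<Longrightarrow> mat_transpose_mult P ths j = 0"
  using kkt by (auto simp: kkt_point_def)

text \<open>Each node and edge block completes its square. The leftover primal and dual coupling
  terms cancel in the sum over the network because \<open>mat_mult\<close> and
  \<open>mat_transpose_mult\<close> are adjoint.\<close>

lemma running_cost_plus_energy_rate:
  assumes nonneg: "tau_nonneg P s"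
  shows "running_cost P ths las s u + energy_rate P ths las mus s u = deviation P s u"
proof -
  have xi: "(\<Sum>k=2..rho_xi P i. R_xi P i k * (u_xi u i k)\<^sup>2) + q_xi P ths las s i
      + (\<Sum>k=1..rho_xi P i. (xi s i k - target (ths i) k) / b_xi P i k * xi_field P s u i k)
    = (\<Sum>k=2..rho_xi P i. R_xi P i k * (u_xi u i k + a_xi P i k * xi s i k)\<^sup>2)
      - (theta P s i - ths i) * (psi P s i - mat_mult P mus i)" if i: "i \<in> nodes P" for i
  proof -
    have "(\<Sum>k=1..rho_xi P i. (xi s i k - target (ths i) k) / b_xi P i k * xi_field P s u i k)
        = (theta P s i - ths i) * phi P s i + (\<Sum>k=2..rho_xi P i. xi s i k * u_xi u i k / b_xi P i k)"
      unfolding xi_field_def theta_def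
      using block_power[of "rho_xi P i" "b_xi P i" "xi s i" "ths i" "phi P s i" "u_xi u i"] rho_ge_1 b_pos i
      by (simp add: theta_def)
    \<comment> \<open>Stationarity says that the drive vanishes at the optimum, so it can be written
      through deviations from there.\<close>
    moreover have "phi P s i = - (deriv (obj P i) (theta P s i) - deriv (obj P i) (ths i))
        - (eta P s i - deriv (con P i) (ths i) * las i) - (psi P s i - mat_mult P mus i)"
      using kktD(1)[OF i] by (simp add: phi_def)
    ultimately show ?thesis
      using block_complete_square[of "rho_xi P i" "a_xi P i" "b_xi P i" "u_xi u i" "xi s i"] a_pos(1) b_pos(1) i
      by (simp add: q_xi_def R_xi_def algebra_simps)
  qed
  have tau: "(\<Sum>k=2..rho_tau P i. R_tau P i k * (u_tau u i k)\<^sup>2) + q_tau P las s i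
      + (\<Sum>k=1..rho_tau P i. (tau s i k - target (las i) k) / b_tau P i k * tau_field P s u i k)
    = (\<Sum>k=2..rho_tau P i. R_tau P i k * (u_tau u i k + a_tau P i k * tau s i k)\<^sup>2)" if i: "i \<in> nodes P" for i
    using block_power_pos_proj[of "rho_tau P i" "b_tau P i" "tau s i" "las i" "con P i (theta P s i)" "u_tau u i"]
      block_complete_square[of "rho_tau P i" "a_tau P i" "b_tau P i" "u_tau u i" "tau s i"]
      rho_ge_1(2) a_pos(2) b_pos(2) i nonneg
    by (simp add: tau_field_def q_tau_def R_tau_def tau_nonneg_def algebra_simps)
  have zeta: "(\<Sum>k=2..rho_zeta P j. R_zeta P j k * (u_zeta u j k)\<^sup>2) + q_zeta P s j
      + (\<Sum>k=1..rho_zeta P j. (zeta s j k - target (mus j) k) / b_zeta P j k * zeta_field P s u j k)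
    = (\<Sum>k=2..rho_zeta P j. R_zeta P j k * (u_zeta u j k + a_zeta P j k * zeta s j k)\<^sup>2)
      + (mu P s j - mus j) * omega P s j" if j: "j \<in> edges P" for j
    using block_power[of "rho_zeta P j" "b_zeta P j" "zeta s j" "mus j" "omega P s j" "u_zeta u j"]
      block_complete_square[of "rho_zeta P j" "a_zeta P j" "b_zeta P j" "u_zeta u j" "zeta s j"]
      rho_ge_1(3) a_pos(3) b_pos(3) j
    by (simp add: zeta_field_def q_zeta_def R_zeta_def mu_def algebra_simps)
  \<comment> \<open>The interconnection is lossless: exchanging the two sums moves the matrix to the
    primal side, where feasibility of \<open>ths\<close> removes the constant term.\<close>
  have "(\<Sum>i\<in>nodes P. (theta P s i - ths i) * (psi P s i - mat_mult P mus i))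
      = (\<Sum>i\<in>nodes P. \<Sum>j\<in>edges P. mat P i j * (theta P s i - ths i) * (mu P s j - mus j))"
    by (simp add: psi_def mat_mult_def sum_subtractf[symmetric] sum_distrib_left algebra_simps)
  also have "\<dots> = (\<Sum>j\<in>edges P. \<Sum>i\<in>nodes P. mat P i j * (theta P s i - ths i) * (mu P s j - mus j))"
    by (rule sum.swap)
  also have "\<dots> = (\<Sum>j\<in>edges P. (mu P s j - mus j) * (omega P s j - mat_transpose_mult P ths j))"
    by (simp add: omega_def mat_transpose_mult_def sum_subtractf[symmetric] sum_distrib_left algebra_simps)
  also have "\<dots> = (\<Sum>j\<in>edges P. (mu P s j - mus j) * omega P s j)"
    by (simp add: kktD)
  finally have adjoint: "(\<Sum>i\<in>nodes P. (theta P s i - ths i) * (psi P s i - mat_mult P mus i))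
      = (\<Sum>j\<in>edges P. (mu P s j - mus j) * omega P s j)" .
  show ?thesis
    using sum.cong[OF refl xi, of "nodes P" "\<lambda>i. i"] sum.cong[OF refl tau, of "nodes P" "\<lambda>i. i"]
      sum.cong[OF refl zeta, of "edges P" "\<lambda>j. j"] adjoint
    by (simp add: running_cost_def R_norm_sq_def energy_rate_def deviation_def sum.distrib sum_subtractf)
qed

lemma deviation_nonneg: "0 \<le> deviation P s u"
  unfolding deviation_def
  by (intro add_nonneg_nonneg sum_nonneg mult_nonneg_nonneg zero_le_power2) (simp_all add: R_pos less_imp_le)

lemma R_norm_sq_nonneg: "0 \<le> R_norm_sq P u"
  unfolding R_norm_sq_def
  by (intro add_nonneg_nonneg sum_nonneg mult_nonneg_nonneg zero_le_power2) (simp_all add: R_pos less_imp_le)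

text \<open>The primal and multiplier terms of a node are estimated together: convexity of the
  constraint lets the coupling term in \<open>q_xi\<close> absorb the constraint terms in
  \<open>q_tau\<close>.\<close>

lemma running_cost_nonneg:
  assumes nonneg: "tau_nonneg P s"
  shows "0 \<le> running_cost P ths las s u"
proof -
  have node: "0 \<le> q_xi P ths las s i + q_tau P las s i" if i: "i \<in> nodes P" for i
  proof -
    define G G' th where "G = con P i" and "G' = deriv (con P i)" and "th = theta P s i"
    note defs = G_def G'_def th_def
    have convex_con: "G' x * (y - x) \<le> G y - G x" for x y
      using smooth_convexD(3)[OF smooth_convex(2)[OF i]] by (simp add: defs)
    have tau1: "0 \<le> tau s i 1" and lam: "0 \<le> lam P s i"
      using nonneg i rho_ge_1(2)[OF i] by (auto simp: tau_nonneg_def lam_def intro!: sum_nonneg)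
    have las: "0 \<le> las i" using kktD(3)[OF i] .
    \<comment> \<open>If the projection is active, then \<open>tau s i 1 = 0\<close> and the
      constraint value is negative, so the right-hand side is a product of two nonpositive
      numbers.\<close>
    have "(tau s i 1 - las i) * pos_proj (G th) (tau s i 1) \<le> (tau s i 1 - las i) * G th"
      using tau1 las by (auto simp: pos_proj_def mult_nonneg_nonpos)
    moreover have "lam P s i = tau s i 1 + (\<Sum>k=2..rho_tau P i. tau s i k)"
      using rho_ge_1(2)[OF i] by (simp add: lam_def sum.atLeast_Suc_atMost numeral_2_eq_2)
    ultimately have proj: "0 \<le> (lam P s i - las i) * G th
        + (las i - tau s i 1) * pos_proj (G th) (tau s i 1) - (\<Sum>k=2..rho_tau P i. tau s i k * G th)"
      by (simp add: algebra_simps sum_distrib_left)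
    \<comment> \<open>Tangent inequality at the current point weighted by the current multiplier;
      next, the one at the optimum weighted by the optimal multiplier. Complementary slackness and
      feasibility then remove the values at the optimum.\<close>
    have "lam P s i * (G th - G (ths i)) \<le> lam P s i * (G' th * (th - ths i))"
      using convex_con[of th "ths i"] lam by (intro mult_left_mono) (auto simp: algebra_simps)
    moreover have "las i * (G' (ths i) * (th - ths i)) \<le> las i * (G th - G (ths i))"
      using convex_con[of "ths i" th] las by (intro mult_left_mono)
    moreover have "las i * G (ths i) = 0" "lam P s i * G (ths i) \<le> 0"
      using kktD(2,4)[OF i] lam by (auto simp: defs mult_nonneg_nonpos)
    ultimately have "(lam P s i - las i) * G th \<le> (th - ths i) * (G' th * lam P s i - G' (ths i) * las i)"
      by (simp add: algebra_simps)
    moreover have "0 \<le> (\<Sum>k=2..rho_xi P i. a_xi P i k / (2 * b_xi P i k) * (xi s i k)\<^sup>2)"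
      "0 \<le> (\<Sum>k=2..rho_tau P i. a_tau P i k / (2 * b_tau P i k) * (tau s i k)\<^sup>2)"
      using a_pos(1,2) b_pos(1,2) i by (auto intro!: sum_nonneg mult_nonneg_nonneg divide_nonneg_pos simp: less_imp_le)
    ultimately show ?thesis
      using proj smooth_convex_deriv_mono[OF smooth_convex(1)[OF i], of th "ths i"]
      by (simp add: q_xi_def q_tau_def eta_def defs)
  qed
  have "0 \<le> q_zeta P s j" if "j \<in> edges P" for j
    unfolding q_zeta_def using a_pos(3)[OF that] b_pos(3)[OF that]
    by (auto intro!: sum_nonneg mult_nonneg_nonneg divide_nonneg_pos simp: less_imp_le)
  then have "0 \<le> (\<Sum>j\<in>edges P. q_zeta P s j)"
    by (rule sum_nonneg)
  moreover have "0 \<le> (\<Sum>i\<in>nodes P. q_xi P ths las s i) + (\<Sum>i\<in>nodes P. q_tau P las s i)"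
    unfolding sum.distrib[symmetric] using node by (rule sum_nonneg)
  ultimately show ?thesis
    using R_norm_sq_nonneg[of u] by (simp add: running_cost_def)
qed

lemma energy_nonneg: "0 \<le> energy P ths las mus s"
  unfolding energy_def
  by (intro add_nonneg_nonneg sum_nonneg divide_nonneg_pos zero_le_power2) (simp_all add: b_pos)

text \<open>All summands are nonnegative, so each is at most the total. This bounds the energy of
  every single disturbance, and forces every input component to match the feedback when the total is
  0.\<close>

lemma deviation_ge:
  shows "i \<in> nodes P \<Longrightarrow> k \<in> {2..rho_xi P i} \<Longrightarrow>
      R_xi P i k * (u_xi u i k + a_xi P i k * xi s i k)\<^sup>2 \<le> deviation P s u"
    and "i \<in> nodes P \<Longrightarrow> k \<in> {2..rho_tau P i} \<Longrightarrow>
      R_tau P i k * (u_tau u i k + a_tau P i k * tau s i k)\<^sup>2 \<le> deviation P s u"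
    and "j \<in> edges P \<Longrightarrow> k \<in> {2..rho_zeta P j} \<Longrightarrow>
      R_zeta P j k * (u_zeta u j k + a_zeta P j k * zeta s j k)\<^sup>2 \<le> deviation P s u"
proof -
  define dx where "dx i k = R_xi P i k * (u_xi u i k + a_xi P i k * xi s i k)\<^sup>2" for i k
  define dt where "dt i k = R_tau P i k * (u_tau u i k + a_tau P i k * tau s i k)\<^sup>2" for i k
  define dz where "dz j k = R_zeta P j k * (u_zeta u j k + a_zeta P j k * zeta s j k)\<^sup>2" for j k
  have dev: "deviation P s u = (\<Sum>i\<in>nodes P. \<Sum>k=2..rho_xi P i. dx i k)
      + (\<Sum>i\<in>nodes P. \<Sum>k=2..rho_tau P i. dt i k) + (\<Sum>j\<in>edges P. \<Sum>k=2..rho_zeta P j. dz j k)"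
    by (simp add: deviation_def dx_def dt_def dz_def)
  have nonneg: "i \<in> nodes P \<Longrightarrow> k \<in> {2..rho_xi P i} \<Longrightarrow> 0 \<le> dx i k"
    "i \<in> nodes P \<Longrightarrow> k \<in> {2..rho_tau P i} \<Longrightarrow> 0 \<le> dt i k"
    "j \<in> edges P \<Longrightarrow> k \<in> {2..rho_zeta P j} \<Longrightarrow> 0 \<le> dz j k" for i j k
    using R_pos by (simp_all add: dx_def dt_def dz_def less_imp_le)
  have le_block: "d i k \<le> (\<Sum>i\<in>I. \<Sum>k=2..n i. d i k)"
    if "finite I" "i \<in> I" "k \<in> {2..n i}" "\<And>i k. i \<in> I \<Longrightarrow> k \<in> {2..n i} \<Longrightarrow> 0 \<le> d i k"
    for d :: "'i \<Rightarrow> nat \<Rightarrow> real" and n I i k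
  proof -
    have "d i k \<le> (\<Sum>k=2..n i. d i k)"
      using that by (intro member_le_sum) auto
    also have "\<dots> \<le> (\<Sum>i\<in>I. \<Sum>k=2..n i. d i k)"
      using that by (intro member_le_sum[of i I "\<lambda>i. \<Sum>k=2..n i. d i k"] sum_nonneg) auto
    finally show ?thesis .
  qed
  have blocks: "0 \<le> (\<Sum>i\<in>nodes P. \<Sum>k=2..rho_xi P i. dx i k)"
    "0 \<le> (\<Sum>i\<in>nodes P. \<Sum>k=2..rho_tau P i. dt i k)"
    "0 \<le> (\<Sum>j\<in>edges P. \<Sum>k=2..rho_zeta P j. dz j k)"
    using nonneg by (auto intro!: sum_nonneg)
  show "R_xi P i k * (u_xi u i k + a_xi P i k * xi s i k)\<^sup>2 \<le> deviation P s u"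
    if "i \<in> nodes P" "k \<in> {2..rho_xi P i}"
    using le_block[of "nodes P" i k "rho_xi P" dx] that nonneg blocks by (simp add: dev dx_def)
  show "R_tau P i k * (u_tau u i k + a_tau P i k * tau s i k)\<^sup>2 \<le> deviation P s u"
    if "i \<in> nodes P" "k \<in> {2..rho_tau P i}"
    using le_block[of "nodes P" i k "rho_tau P" dt] that nonneg blocks by (simp add: dev dt_def)
  show "R_zeta P j k * (u_zeta u j k + a_zeta P j k * zeta s j k)\<^sup>2 \<le> deviation P s u"
    if "j \<in> edges P" "k \<in> {2..rho_zeta P j}"
    using le_block[of "edges P" j k "rho_zeta P" dz] that nonneg blocks by (simp add: dev dz_def)
qed

lemma same_input_if_deviation_0:
  assumes "deviation P (x t) u = 0"
  shows "same_input P u (apd_control P t x)"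
proof -
  have zero: "v = - w" if "R * (v + w)\<^sup>2 \<le> deviation P (x t) u" "0 < R" for R v w :: real
  proof -
    have "(v + w)\<^sup>2 \<le> 0"
      using that assms by (simp add: mult_le_0_iff)
    then show ?thesis by simp
  qed
  show ?thesis
    unfolding same_input_def apd_control_def
    using zero[OF deviation_ge(1) R_pos(1)] zero[OF deviation_ge(2) R_pos(2)] zero[OF deviation_ge(3) R_pos(3)]
    by simp
qed

lemma deviation_apd_control: "deviation P (x t) (apd_control P t x) = 0"
  by (simp add: deviation_def apd_control_def)

section \<open>Continuity and measurability along trajectories\<close>

lemma trajectory_continuous_on:
  assumes "trajectory P s0 U x"
  shows "i \<in> nodes P \<Longrightarrow> k \<in> {1..rho_xi P i} \<Longrightarrow> continuous_on {0..} (\<lambda>t. xi (x t) i k)"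
    "i \<in> nodes P \<Longrightarrow> k \<in> {1..rho_tau P i} \<Longrightarrow> continuous_on {0..} (\<lambda>t. tau (x t) i k)"
    "j \<in> edges P \<Longrightarrow> k \<in> {1..rho_zeta P j} \<Longrightarrow> continuous_on {0..} (\<lambda>t. zeta (x t) j k)"
  using assms caratheodory_solution_continuous_on unfolding trajectory_def by blast+

lemma trajectory_measurable:
  assumes "trajectory P s0 U x"
  shows "i \<in> nodes P \<Longrightarrow> k \<in> {2..rho_xi P i} \<Longrightarrow> (\<lambda>t. xi (x t) i k) \<in> borel_measurable (lebesgue_on {0..})"
    "i \<in> nodes P \<Longrightarrow> k \<in> {2..rho_tau P i} \<Longrightarrow> (\<lambda>t. tau (x t) i k) \<in> borel_measurable (lebesgue_on {0..})"
    "j \<in> edges P \<Longrightarrow> k \<in> {2..rho_zeta P j} \<Longrightarrow> (\<lambda>t. zeta (x t) j k) \<in> borel_measurable (lebesgue_on {0..})"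
  by (intro continuous_imp_measurable_on_sets_lebesgue trajectory_continuous_on[OF assms]; simp)+

lemma deviation_measurable:
  assumes "trajectory P s0 U x" "measurable_input P (\<lambda>t. U t x)"
  shows "(\<lambda>t. deviation P (x t) (U t x)) \<in> borel_measurable (lebesgue_on {0..})"
  unfolding deviation_def
  by (intro borel_measurable_add borel_measurable_sum borel_measurable_times borel_measurable_power
      borel_measurable_const trajectory_measurable[OF assms(1)])
    (use assms(2) in \<open>auto simp: measurable_input_def\<close>)

lemma measurable_input_apd_control:
  assumes "trajectory P s0 U x"
  shows "measurable_input P (\<lambda>t. apd_control P t x)"
  unfolding measurable_input_def apd_control_def
  using trajectory_measurable[OF assms] by (auto intro!: borel_measurable_times)

subsection \<open>Limits of trajectories with finite cost\<close>

lemma energy_tendsto: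
  assumes "state_converges P x s"
  shows "((\<lambda>t. energy P ths las mus (x t)) \<longlongrightarrow> energy P ths las mus s) at_top"
proof -
  have "2 * b_xi P i k \<noteq> 0" if "i \<in> nodes P" "k \<in> {1..rho_xi P i}" for i k
    using b_pos(1)[OF that] by simp
  moreover have "2 * b_tau P i k \<noteq> 0" if "i \<in> nodes P" "k \<in> {1..rho_tau P i}" for i k
    using b_pos(2)[OF that] by simp
  moreover have "2 * b_zeta P j k \<noteq> 0" if "j \<in> edges P" "k \<in> {1..rho_zeta P j}" for j k
    using b_pos(3)[OF that] by simp
  ultimately show ?thesis
    using assms unfolding energy_def state_converges_def
    by (intro tendsto_add tendsto_sum tendsto_divide tendsto_power tendsto_diff tendsto_const) blast+
qed

context
  fixes x :: "real \<Rightarrow> ('v, 'e) state" and s :: "('v, 'e) state"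
  assumes conv: "state_converges P x s"
    and opt: "\<And>i. i \<in> nodes P \<Longrightarrow> theta P s i = ths i" "\<And>i. i \<in> nodes P \<Longrightarrow> lam P s i = las i"
      "\<And>j. j \<in> edges P \<Longrightarrow> mu P s j = mus j"
begin

lemma theta_tendsto: "i \<in> nodes P \<Longrightarrow> ((\<lambda>t. theta P (x t) i) \<longlongrightarrow> ths i) at_top"
  using conv unfolding theta_def opt(1)[unfolded theta_def, symmetric]
  by (intro tendsto_sum) (auto simp: state_converges_def)

lemma lam_tendsto: "i \<in> nodes P \<Longrightarrow> ((\<lambda>t. lam P (x t) i) \<longlongrightarrow> las i) at_top"
  using conv unfolding lam_def opt(2)[unfolded lam_def, symmetric]
  by (intro tendsto_sum) (auto simp: state_converges_def)

lemma mu_tendsto: "j \<in> edges P \<Longrightarrow> ((\<lambda>t. mu P (x t) j) \<longlongrightarrow> mus j) at_top"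
  using conv unfolding mu_def opt(3)[unfolded mu_def, symmetric]
  by (intro tendsto_sum) (auto simp: state_converges_def)

lemma phi_tendsto_0:
  assumes i: "i \<in> nodes P"
  shows "((\<lambda>t. phi P (x t) i) \<longlongrightarrow> 0) at_top"
proof -
  have "((\<lambda>t. phi P (x t) i) \<longlongrightarrow>
      - deriv (obj P i) (ths i) - deriv (con P i) (ths i) * las i - mat_mult P mus i) at_top"
    unfolding phi_def eta_def psi_def mat_mult_def
    by (intro tendsto_intros smooth_convex_tendsto(2)[OF smooth_convex(1)[OF i]]
        smooth_convex_tendsto(2)[OF smooth_convex(2)[OF i]] theta_tendsto[OF i] lam_tendsto[OF i] mu_tendsto)
  moreover have "- deriv (obj P i) (ths i) - deriv (con P i) (ths i) * las i - mat_mult P mus i = 0"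
    using kktD(1)[OF i] by linarith
  ultimately show ?thesis
    by simp
qed

lemma omega_tendsto_0:
  assumes j: "j \<in> edges P"
  shows "((\<lambda>t. omega P (x t) j) \<longlongrightarrow> 0) at_top"
proof -
  have "((\<lambda>t. omega P (x t) j) \<longlongrightarrow> mat_transpose_mult P ths j) at_top"
    unfolding omega_def mat_transpose_mult_def by (intro tendsto_intros theta_tendsto)
  then show ?thesis
    using kktD(5)[OF j] by simp
qed

text \<open>Near the optimum the drives \<open>phi\<close> and \<open>omega\<close> tend to 0, so an
  augmented component is damped up to the disturbance \<open>u + a * x\<close>, whose energy is
  bounded through the deviation. For \<open>tau\<close> a positive limit would make both the
  constraint value vanish in the limit and the projection inactive.\<close>

lemma limit_augmentation_zero:
  fixes K :: real
  assumes traj: "trajectory P s0 U x"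
    and dev: "\<And>T. 0 \<le> T \<Longrightarrow> (\<lambda>t. deviation P (x t) (U t x)) integrable_on {0..T}"
      "\<And>T. 0 \<le> T \<Longrightarrow> integral {0..T} (\<lambda>t. deviation P (x t) (U t x)) \<le> K"
  shows "i \<in> nodes P \<Longrightarrow> k \<in> {2..rho_xi P i} \<Longrightarrow> xi s i k = 0"
    "i \<in> nodes P \<Longrightarrow> k \<in> {2..rho_tau P i} \<Longrightarrow> tau s i k = 0"
    "j \<in> edges P \<Longrightarrow> k \<in> {2..rho_zeta P j} \<Longrightarrow> zeta s j k = 0"
proof -
  have bound: "w\<^sup>2 \<le> 1 / R * d" if "R * w\<^sup>2 \<le> d" "0 < R" for R w d :: real
    using that by (simp add: field_simps)
  show "xi s i k = 0" if i: "i \<in> nodes P" and k: "k \<in> {2..rho_xi P i}"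
  proof (rule dissipative_limit_zero)
    show "caratheodory_solution (\<lambda>t. xi_field P (x t) (U t x) i k) (\<lambda>t. xi (x t) i k) (xi s0 i k)"
      using traj i k by (simp add: trajectory_def)
    show "((\<lambda>t. xi (x t) i k) \<longlongrightarrow> xi s i k) at_top"
      using conv i k by (simp add: state_converges_def)
    show "((\<lambda>t. b_xi P i k * phi P (x t) i) \<longlongrightarrow> 0) at_top"
      using phi_tendsto_0[OF i] by (rule tendsto_mult_right_zero)
    show "\<forall>\<^sub>F t in at_top. xi_field P (x t) (U t x) i k = b_xi P i k * phi P (x t) i
        - a_xi P i k * xi (x t) i k + (u_xi (U t x) i k + a_xi P i k * xi (x t) i k)"
      using k by (simp add: xi_field_def embed_input_def)
    show "\<forall>\<^sub>F t in at_top. (u_xi (U t x) i k + a_xi P i k * xi (x t) i k)\<^sup>2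
        \<le> 1 / R_xi P i k * deviation P (x t) (U t x)"
      using bound[OF deviation_ge(1)[OF i k] R_pos(1)[OF i k]] by simp
  qed (use a_pos(1)[OF i k] R_pos(1)[OF i k] deviation_nonneg dev in auto)
  show "zeta s j k = 0" if j: "j \<in> edges P" and k: "k \<in> {2..rho_zeta P j}"
  proof (rule dissipative_limit_zero)
    show "caratheodory_solution (\<lambda>t. zeta_field P (x t) (U t x) j k) (\<lambda>t. zeta (x t) j k) (zeta s0 j k)"
      using traj j k by (simp add: trajectory_def)
    show "((\<lambda>t. zeta (x t) j k) \<longlongrightarrow> zeta s j k) at_top"
      using conv j k by (simp add: state_converges_def)
    show "((\<lambda>t. b_zeta P j k * omega P (x t) j) \<longlongrightarrow> 0) at_top"
      using omega_tendsto_0[OF j] by (rule tendsto_mult_right_zero)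
    show "\<forall>\<^sub>F t in at_top. zeta_field P (x t) (U t x) j k = b_zeta P j k * omega P (x t) j
        - a_zeta P j k * zeta (x t) j k + (u_zeta (U t x) j k + a_zeta P j k * zeta (x t) j k)"
      using k by (simp add: zeta_field_def embed_input_def)
    show "\<forall>\<^sub>F t in at_top. (u_zeta (U t x) j k + a_zeta P j k * zeta (x t) j k)\<^sup>2
        \<le> 1 / R_zeta P j k * deviation P (x t) (U t x)"
      using bound[OF deviation_ge(3)[OF j k] R_pos(3)[OF j k]] by simp
  qed (use a_pos(3)[OF j k] R_pos(3)[OF j k] deviation_nonneg dev in auto)
  show "tau s i k = 0" if i: "i \<in> nodes P" and k: "k \<in> {2..rho_tau P i}"
  proof (rule ccontr)
    have traj_nonneg: "0 \<le> tau (x t) i k" if "0 \<le> t" for t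
      using traj i k that by (auto simp: trajectory_def tau_nonneg_def)
    have lim: "((\<lambda>t. tau (x t) i k') \<longlongrightarrow> tau s i k') at_top" if "k' \<in> {1..rho_tau P i}" for k'
      using conv i that by (simp add: state_converges_def)
    have lim_nonneg: "0 \<le> tau s i k'" if "k' \<in> {1..rho_tau P i}" for k'
    proof (rule tendsto_lowerbound[OF lim[OF that]])
      show "\<forall>\<^sub>F t in at_top. 0 \<le> tau (x t) i k'"
        using traj i that by (intro eventually_at_top_linorderI[of 0]) (auto simp: trajectory_def tau_nonneg_def)
    qed simp
    assume "tau s i k \<noteq> 0"
    then have pos: "0 < tau s i k"
      using lim_nonneg[of k] k by auto
    have "tau s i k \<le> lam P s i"
      unfolding lam_def using k lim_nonneg by (intro member_le_sum) auto
    \<comment> \<open>By complementary slackness the constraint is active at the optimum.\<close>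
    then have con0: "con P i (ths i) = 0"
      using kktD(2)[OF i] opt(2)[OF i] pos by auto
    \<comment> \<open>The one-sided estimate suffices here, since the limit is assumed
      positive.\<close>
    have "tau s i k \<le> 0"
    proof (rule dissipative_limit_nonpos)
      show "caratheodory_solution (\<lambda>t. tau_field P (x t) (U t x) i k) (\<lambda>t. tau (x t) i k) (tau s0 i k)"
        using traj i k by (simp add: trajectory_def)
      show "((\<lambda>t. tau (x t) i k) \<longlongrightarrow> tau s i k) at_top"
        using lim k by simp
      have "((\<lambda>t. con P i (theta P (x t) i)) \<longlongrightarrow> con P i (ths i)) at_top"
        by (intro smooth_convex_tendsto(1)[OF smooth_convex(2)[OF i]] theta_tendsto[OF i])
      then show "((\<lambda>t. b_tau P i k * con P i (theta P (x t) i)) \<longlongrightarrow> 0) at_top"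
        unfolding con0 by (rule tendsto_mult_right_zero)
      \<comment> \<open>Eventual positivity switches the projection off and leaves the unprojected
        linear equation.\<close>
      have "\<forall>\<^sub>F t in at_top. 0 < tau (x t) i k"
        using lim[of k] pos k by (intro order_tendstoD(1)[of _ "tau s i k"]) auto
      then show "\<forall>\<^sub>F t in at_top. tau_field P (x t) (U t x) i k = b_tau P i k * con P i (theta P (x t) i)
          - a_tau P i k * tau (x t) i k + (u_tau (U t x) i k + a_tau P i k * tau (x t) i k)"
        by eventually_elim (use k in \<open>simp add: tau_field_def embed_input_def pos_proj_def\<close>)
      show "\<forall>\<^sub>F t in at_top. (u_tau (U t x) i k + a_tau P i k * tau (x t) i k)\<^sup>2
          \<le> 1 / R_tau P i k * deviation P (x t) (U t x)"
        using bound[OF deviation_ge(2)[OF i k] R_pos(2)[OF i k]] by simp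
    qed (use a_pos(2)[OF i k] R_pos(2)[OF i k] deviation_nonneg dev in auto)
    then show False
      using pos by simp
  qed
qed

text \<open>Once the components from index 2 on vanish, the prescribed block sum sits entirely in
  the first component, which is the target point.\<close>

lemma limit_energy_zero:
  fixes K :: real
  assumes "trajectory P s0 U x"
    and "\<And>T. 0 \<le> T \<Longrightarrow> (\<lambda>t. deviation P (x t) (U t x)) integrable_on {0..T}"
      "\<And>T. 0 \<le> T \<Longrightarrow> integral {0..T} (\<lambda>t. deviation P (x t) (U t x)) \<le> K"
  shows "energy P ths las mus s = 0"
proof -
  have eq_target: "z k = target c k"
    if "k \<in> {1..n}" "\<And>k. k \<in> {2..n} \<Longrightarrow> z k = 0" "(\<Sum>k=1..n. z k) = c" for z :: "nat \<Rightarrow> real" and n c k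
  proof -
    have "(\<Sum>k=1..n. z k) = z 1 + (\<Sum>k=2..n. z k)"
      using that by (simp add: sum.atLeast_Suc_atMost numeral_2_eq_2)
    then have "z 1 = c"
      using that by simp
    then show ?thesis
      using that by (auto simp: target_def)
  qed
  have zero: "i \<in> nodes P \<Longrightarrow> k \<in> {2..rho_xi P i} \<Longrightarrow> xi s i k = 0"
    "i \<in> nodes P \<Longrightarrow> k \<in> {2..rho_tau P i} \<Longrightarrow> tau s i k = 0"
    "j \<in> edges P \<Longrightarrow> k \<in> {2..rho_zeta P j} \<Longrightarrow> zeta s j k = 0" for i j k
    using limit_augmentation_zero[OF assms] by blast+
  have "xi s i k = target (ths i) k" if "i \<in> nodes P" "k \<in> {1..rho_xi P i}" for i k
    using eq_target[OF that(2), of "xi s i"] zero(1)[OF that(1)] opt(1)[OF that(1)] by (simp add: theta_def)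
  moreover have "tau s i k = target (las i) k" if "i \<in> nodes P" "k \<in> {1..rho_tau P i}" for i k
    using eq_target[OF that(2), of "tau s i"] zero(2)[OF that(1)] opt(2)[OF that(1)] by (simp add: lam_def)
  moreover have "zeta s j k = target (mus j) k" if "j \<in> edges P" "k \<in> {1..rho_zeta P j}" for j k
    using eq_target[OF that(2), of "zeta s j"] zero(3)[OF that(1)] opt(3)[OF that(1)] by (simp add: mu_def)
  ultimately show ?thesis
    by (simp add: energy_def)
qed

end

subsection \<open>Cost of stabilizing controls\<close>

lemma cost_eq_nn_integral:
  assumes "trajectory P s0 U x"
  shows "cost P ths las U x
    = enn2ereal (\<integral>\<^sup>+ t. ennreal (running_cost P ths las (x t) (U t x)) \<partial>lebesgue_on {0..})"
  unfolding cost_def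
  by (rule ext_integral_nonneg) (use assms running_cost_nonneg in \<open>auto simp: trajectory_def\<close>)

lemma running_cost_eq:
  assumes "trajectory P s0 U x" "0 \<le> t"
  shows "running_cost P ths las (x t) (U t x)
    = deviation P (x t) (U t x) - energy_rate P ths las mus (x t) (U t x)"
  using running_cost_plus_energy_rate[of "x t" "U t x"] assms by (simp add: trajectory_def)

text \<open>Integrate deviation = running cost + energy rate over \<open>{0..T}\<close>. The running
  cost contributes at most \<open>C\<close>; the energy rate contributes the increment of the
  energy.\<close>

lemma finite_cost_deviation:
  assumes traj: "trajectory P s0 U x" and meas: "measurable_input P (\<lambda>t. U t x)"
    and cost: "cost P ths las U x \<le> ereal C" and T: "0 \<le> T"
  shows "(\<lambda>t. deviation P (x t) (U t x)) integrable_on {0..T}"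
    and "integral {0..T} (\<lambda>t. deviation P (x t) (U t x))
      \<le> C + energy P ths las mus (x T) - energy P ths las mus s0"
proof -
  define r where "r t = running_cost P ths las (x t) (U t x)" for t
  define d where "d = (\<lambda>t. deviation P (x t) (U t x))"
  define v where "v t = energy_rate P ths las mus (x t) (U t x)" for t
  have sol: "caratheodory_solution v (\<lambda>t. energy P ths las mus (x t)) (energy P ths las mus s0)"
    unfolding v_def using setting traj by (rule energy_along_trajectory)
  have r_nonneg: "0 \<le> r t" if "0 \<le> t" for t
    using that traj running_cost_nonneg by (simp add: r_def trajectory_def)
  have r: "r t = d t - v t" if "0 \<le> t" for t
    using running_cost_eq[OF traj that] by (simp add: r_def d_def v_def)
  have "0 \<le> enn2ereal (\<integral>\<^sup>+ t. ennreal (r t) \<partial>lebesgue_on {0..})"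
    by simp
  moreover have cost': "enn2ereal (\<integral>\<^sup>+ t. ennreal (r t) \<partial>lebesgue_on {0..}) \<le> ereal C"
    using cost by (simp add: cost_eq_nn_integral[OF traj] r_def)
  \<comment> \<open>The sign is settled first because \<open>ennreal\<close> clips negative numbers,
    so the bound could not be transferred otherwise.\<close>
  ultimately have C: "0 \<le> C"
    using order_trans by (metis ereal_less_eq(5))
  have nn: "(\<integral>\<^sup>+ t. ennreal (r t) \<partial>lebesgue_on {0..}) \<le> ennreal C"
    using cost' C by (simp add: less_eq_ennreal.rep_eq)
  have r_int: "r integrable_on {0..S}" for S
  proof (cases "0 \<le> S")
    case True
    have "d \<in> borel_measurable (lebesgue_on {0..S})"
      using deviation_measurable[OF traj meas] unfolding d_def by (rule measurable_restrict_mono) auto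
    moreover have "v \<in> borel_measurable (lebesgue_on {0..S})"
      using caratheodory_solutionD(1)[OF sol True] by (simp add: absolutely_integrable_measurable_real)
    ultimately have "(\<lambda>t. d t - v t) \<in> borel_measurable (lebesgue_on {0..S})"
      by (rule borel_measurable_diff)
    then have "r \<in> borel_measurable (lebesgue_on {0..S})"
      using r by (subst measurable_cong[where g = "\<lambda>t. d t - v t"]) auto
    then show ?thesis
      using r_nonneg nn by (intro integrable_on_Icc_if_nn_integral_finite) (auto intro: le_less_trans)
  qed (simp add: integrable_on_empty)
  have v_int: "v integrable_on {0..T}"
    using caratheodory_solutionD(1)[OF sol T] by (rule set_lebesgue_integral_eq_integral(1))
  have "(\<lambda>t. r t + v t) integrable_on {0..T}"
    using r_int v_int by (rule integrable_add)
  moreover have eq: "r t + v t = d t" if "t \<in> {0..T}" for t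
    using r that by simp
  ultimately have "d integrable_on {0..T}"
    by (rule integrable_eq)
  then show "(\<lambda>t. deviation P (x t) (U t x)) integrable_on {0..T}"
    by (simp add: d_def)
  obtain n :: nat where n: "T \<le> real n"
    using real_arch_simple by blast
  have "ennreal (integral {0..real n} r) \<le> (SUP n. ennreal (integral {0..real n} r))"
    by (rule SUP_upper) simp
  also have "\<dots> = (\<integral>\<^sup>+ t. ennreal (r t) \<partial>lebesgue_on {0..})"
    using r_nonneg r_int by (intro nn_integral_atLeast_eq_SUP[symmetric])
  also note nn
  finally have "integral {0..real n} r \<le> C"
    using C by simp
  moreover have "integral {0..T} r \<le> integral {0..real n} r"
    using r_int r_nonneg n by (intro integral_subset_le) auto
  moreover have "integral {0..T} d = integral {0..T} r + integral {0..T} v"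
    using Henstock_Kurzweil_Integration.integral_add[OF r_int v_int]
      Henstock_Kurzweil_Integration.integral_cong[of "{0..T}" "\<lambda>t. r t + v t" d] eq by simp
  moreover have "energy P ths las mus (x T) = energy P ths las mus s0 + integral {0..T} v"
    by (rule caratheodory_solutionD(2)[OF sol T])
  ultimately show "integral {0..T} (\<lambda>t. deviation P (x t) (U t x))
      \<le> C + energy P ths las mus (x T) - energy P ths las mus s0"
    by (simp add: d_def)
qed

text \<open>The energy bound is used twice. Convergence of the energy first bounds all deviation
  integrals uniformly, which forces the limiting energy to be 0; this value then sharpens the same
  bound.\<close>

lemma finite_cost_excess:
  assumes stab: "stabilizing P s0 ths las mus U x" and cost: "cost P ths las U x \<le> ereal C" and T: "0 \<le> T"
  shows "integral {0..T} (\<lambda>t. deviation P (x t) (U t x)) \<le> C - energy P ths las mus s0"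
proof -
  have traj: "trajectory P s0 U x" and meas: "measurable_input P (\<lambda>t. U t x)"
    and "converges_to_optimum P ths las mus x"
    using stab by (auto simp: stabilizing_def)
  then obtain s where conv: "state_converges P x s"
    and opt: "\<And>i. i \<in> nodes P \<Longrightarrow> theta P s i = ths i" "\<And>i. i \<in> nodes P \<Longrightarrow> lam P s i = las i"
      "\<And>j. j \<in> edges P \<Longrightarrow> mu P s j = mus j"
    unfolding converges_to_optimum_def by blast
  note dev = finite_cost_deviation[OF traj meas cost]
  let ?I = "\<lambda>T. integral {0..T} (\<lambda>t. deviation P (x t) (U t x))"
  let ?E = "energy P ths las mus"
  have mono: "?I S \<le> ?I T" if "0 \<le> S" "S \<le> T" for S T
    using that dev(1) deviation_nonneg by (intro integral_subset_le) auto
  \<comment> \<open>With \<open>S\<close> fixed, the integral up to \<open>S\<close> is below the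
    one up to any later \<open>T\<close>, and \<open>T\<close> tends to infinity on the
    right.\<close>
  have lim: "?I S \<le> C + ?E s - ?E s0" if S: "0 \<le> S" for S
  proof (rule tendsto_lowerbound)
    show "((\<lambda>T. C + ?E (x T) - ?E s0) \<longlongrightarrow> C + ?E s - ?E s0) at_top"
      by (intro tendsto_intros energy_tendsto[OF conv])
    show "\<forall>\<^sub>F T in at_top. ?I S \<le> C + ?E (x T) - ?E s0"
      using S mono dev(2) by (intro eventually_at_top_linorderI[of S]) (meson order_trans)
  qed simp
  have "?E s = 0"
    using conv opt traj dev(1) lim by (rule limit_energy_zero)
  then show ?thesis
    using lim[OF T] by simp
qed

lemma cost_ge_energy:
  assumes "stabilizing P s0 ths las mus U x"
  shows "ereal (energy P ths las mus s0) \<le> cost P ths las U x"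
\<comment> \<open>It suffices to consider real upper bounds \<open>C\<close> of the cost; an
  infinite cost has none.\<close>
proof (rule ereal_le_real)
  fix C assume "cost P ths las U x \<le> ereal C"
  from finite_cost_excess[OF assms this, of 0]
  show "ereal (energy P ths las mus s0) \<le> ereal C"
    by simp
qed

text \<open>Under the feedback the deviation vanishes, so the cost up to time \<open>n\<close> is
  the energy lost so far, at most the initial energy because energy is nonnegative.\<close>

lemma apd_cost_le_energy:
  assumes traj: "trajectory P s0 (apd_control P) x"
  shows "cost P ths las (apd_control P) x \<le> ereal (energy P ths las mus s0)"
proof -
  define r where "r t = running_cost P ths las (x t) (apd_control P t x)" for t
  define v where "v t = energy_rate P ths las mus (x t) (apd_control P t x)" for t
  have sol: "caratheodory_solution v (\<lambda>t. energy P ths las mus (x t)) (energy P ths las mus s0)"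
    unfolding v_def using setting traj by (rule energy_along_trajectory)
  have r_nonneg: "0 \<le> r t" if "0 \<le> t" for t
    using that traj running_cost_nonneg by (simp add: r_def trajectory_def)
  have r: "r t = - v t" if "0 \<le> t" for t
    using running_cost_eq[OF traj that] by (simp add: r_def v_def deviation_apd_control)
  have "caratheodory_solution r (\<lambda>t. - 1 * energy P ths las mus (x t)) (- 1 * energy P ths las mus s0)"
    using caratheodory_solution_cmult[OF sol] by (rule caratheodory_solution_cong) (use r in simp)
  note r_sol = caratheodory_solutionD[OF this]
  have r_int: "r integrable_on {0..S}" for S
    using set_lebesgue_integral_eq_integral(1)[OF r_sol(1)] by (cases "0 \<le> S") (auto simp: integrable_on_empty)
  have "(\<integral>\<^sup>+ t. ennreal (r t) \<partial>lebesgue_on {0..}) = (SUP n. ennreal (integral {0..real n} r))"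
    using r_nonneg r_int by (intro nn_integral_atLeast_eq_SUP)
  also have "\<dots> \<le> ennreal (energy P ths las mus s0)"
  proof (intro SUP_least ennreal_leI)
    fix n
    show "integral {0..real n} r \<le> energy P ths las mus s0"
      using r_sol(2)[of "real n"] energy_nonneg[of "x (real n)"] by simp
  qed
  finally show ?thesis
    unfolding cost_eq_nn_integral[OF traj] r_def
    by (simp add: less_eq_ennreal.rep_eq energy_nonneg)
qed

end

section \<open>Optimality of the feedback and almost everywhere uniqueness of the input\<close>

theorem proposition1:
  fixes P :: "('v, 'e) pd_system"
    and s0 :: "('v, 'e) state"
    and ths las :: "'v \<Rightarrow> real" and mus :: "'e \<Rightarrow> real"
    and x :: "real \<Rightarrow> ('v, 'e) state"
  assumes "pd_setting P"
    and "tau_nonneg P s0"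
    and "kkt_point P ths las mus"
    and "trajectory P s0 (apd_control P) x"
    and "converges_to_optimum P ths las mus x"
  shows "optimal_control P s0 ths las mus (apd_control P) x \<and>
    (\<forall>W y. optimal_control P s0 ths las mus W y \<longrightarrow>
       (AE t in lebesgue_on {0..}. same_input P (W t y) (apd_control P t y)))"
proof -
  interpret pd_optimum P ths las mus
    by unfold_locales fact+
  have "causal (apd_control P)"
    by (simp add: causal_def apd_control_def)
  then have stab: "stabilizing P s0 ths las mus (apd_control P) x"
    using assms(4,5) measurable_input_apd_control by (simp add: stabilizing_def)
  note apd_cost = apd_cost_le_energy[OF assms(4)]
  show ?thesis
  proof (intro conjI allI impI)
    show "optimal_control P s0 ths las mus (apd_control P) x"
      unfolding optimal_control_def using stab order_trans[OF apd_cost cost_ge_energy] by blast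
  next
    fix W y
    assume W: "optimal_control P s0 ths las mus W y"
    define d where "d = (\<lambda>t. deviation P (y t) (W t y))"
    have stab_W: "stabilizing P s0 ths las mus W y"
      using W by (simp add: optimal_control_def)
    then have traj: "trajectory P s0 W y" and meas: "measurable_input P (\<lambda>t. W t y)"
      by (auto simp: stabilizing_def)
    \<comment> \<open>An optimal \<open>W\<close> costs no more than the feedback. With this
      \<open>C\<close> the excess bound becomes 0, so the deviation along \<open>y\<close> has zero
      integral and vanishes almost everywhere.\<close>
    have cost: "cost P ths las W y \<le> ereal (energy P ths las mus s0)"
      using W stab apd_cost order_trans unfolding optimal_control_def by blast
    have int: "d integrable_on {0..T}" for T
      using finite_cost_deviation(1)[OF traj meas cost] unfolding d_def by (cases "0 \<le> T") (auto simp: integrable_on_empty)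
    have d_nonneg: "0 \<le> d t" for t
      by (simp add: d_def deviation_nonneg)
    have "integral {0..T} d \<le> 0" if "0 \<le> T" for T
      using finite_cost_excess[OF stab_W cost that] by (simp add: d_def)
    \<comment> \<open>The integrals are only known to be nonpositive; \<open>ennreal\<close> turns
      them into 0.\<close>
    then have "(SUP n. ennreal (integral {0..real n} d)) = (SUP n::nat. 0)"
      by (intro SUP_cong refl) (simp add: ennreal_neg)
    then have "(\<integral>\<^sup>+ t. ennreal (d t) \<partial>lebesgue_on {0..}) = 0"
      using d_nonneg int by (subst nn_integral_atLeast_eq_SUP) auto
    moreover have "(\<lambda>t. ennreal (d t)) \<in> borel_measurable (lebesgue_on {0..})"
      using deviation_measurable[OF traj meas] by (simp add: d_def)
    ultimately have "AE t in lebesgue_on {0..}. ennreal (d t) = 0"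
      by (simp add: nn_integral_0_iff_AE)
    then show "AE t in lebesgue_on {0..}. same_input P (W t y) (apd_control P t y)"
      by eventually_elim
        (use d_nonneg in \<open>auto simp: d_def intro!: same_input_if_deviation_0 antisym deviation_nonneg\<close>)
  qed
qed

end
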